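(* A permutad $(\mathcal{P},\Gamma,\iota)$ is completely determined by the arity-graded module $\{\mathcal{P}_n\}_{n\ge1}$, with $\mathcal{P}_1=\mathbb{K}$, and the partial operations $$\circ_t:\mathcal{P}_{m+1}\otimes\mathcal{P}_{n+1}\to\mathcal{P}_{m+n+1},\qquad t:\underline{m+n}\to\underline{2}\ \text{surjective},\ n=\#t^{-1}(1),$$ satisfying $$(\diamondsuit)\qquad(\lambda\circ_s\mu)\circ_t\nu=\lambda\circ_u(\mu\circ_v\nu)$$ for every surjective map $r$ with target $\underline{3}$, where $n=\#r^{-1}(1)$, $m=\#r^{-1}(2)$, $l=\#r^{-1}(3)$, $s,t,u,v$ are the surjections with target $\underline{2}$ such that $(t;c_{n+1},s)=r=(u;v,c_{l+1})$, and $\lambda\in\mathcal{P}_{l+1}$, $\mu\in\mathcal{P}_{m+1}$, $\nu\in\mathcal{P}_{n+1}$ are arbitrary. That is: for a fixed arity-graded module $\mathcal{P}$ with $\mathcal{P}_1=\mathbb{K}\,\mathrm{id}$, the assignment $\mu\circ_t\nu:=\Gamma(t;\nu,\mu)$ is a bijection from permutad structures $\Gamma$ on $\mathcal{P}$ onto families of linear maps $\circ_t$ (indexed by surjections $t$ with target $\underline{2}$) satisfying $(\diamondsuit)$.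
   Context: $\mathbb{K}$ is a commutative ring; $\underline{n}=\{1,\dots,n\}$. An arity-graded module is a family $\{\mathcal{P}_n\}_{n\ge1}$ of $\mathbb{K}$-modules. $\mathrm{Sur}(\underline{n},\underline{k})$ is the set of surjections $\underline{n}\to\underline{k}$; the unique element of $\mathrm{Sur}(\underline{n},\underline{1})$ is the corolla $c_{n+1}$. Substitution: for $t\in\mathrm{Sur}(\underline{n},\underline{k})$ and $t_j\in\mathrm{Sur}(\underline{i_j},\underline{m_j})$ with $i_j=\#t^{-1}(j)$, $(t;t_1,\dots,t_k):\underline{n}\to\underline{m_1+\cdots+m_k}$ is the surjection with $(t;t_1,\dots,t_k)(a)=m_1+\cdots+m_{j-1}+t_j(b)$ whenever $t(a)=j$ and $a$ is the $b$-th element of $t^{-1}(j)$ in increasing order. A permutad is a unital algebra over the monad of surjective maps. Explicitly, it is an arity-graded module $\mathcal{P}$ with $\mathcal{P}_1=\mathbb{K}\,\mathrm{id}$ together with, for each surjection $t:\underline{n}\to\underline{k}$ ($1\le k\le n$), a linear map $\Gamma(t;-,\dots,-):\bigotimes_{j=1}^k\mathcal{P}_{\#t^{-1}(j)+1}\to\mathcal{P}_{n+1}$, such that $\Gamma(c_{n+1};\mu)=\mu$ and $\Gamma$ is compatible with substitution: $$\Gamma\big((t;t_1,\dots,t_k);\lambda^1_1,\dots,\lambda^1_{m_1},\dots,\lambda^k_{m_k}\big)=\Gamma\big(t;\Gamma(t_1;\lambda^1_1,\dots,\lambda^1_{m_1}),\dots,\Gamma(t_k;\lambda^k_1,\dots,\lambda^k_{m_k})\big)$$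 whenever both sides make sense. *)

theory Defs
  imports "HOL-Algebra.Module" "HOL-Library.FuncSet"
begin

text \<open>
  The set \<open>{1,\<dots>,n}\<close> is \<^term>\<open>{1..n}\<close>.  All maps are extensional (equal to \<open>undefined\<close> outside
  their domain), so that equality of HOL functions is equality of maps between sets.
\<close>

subsection \<open>Surjections and substitution\<close>

definition Sur :: "nat \<Rightarrow> nat \<Rightarrow> (nat \<Rightarrow> nat) set" where
  "Sur n k = {t \<in> {1..n} \<rightarrow>\<^sub>E {1..k}. t ` {1..n} = {1..k}}"

definition corolla :: "nat \<Rightarrow> (nat \<Rightarrow> nat)" where
  "corolla N = (\<lambda>a \<in> {1..N - 1}. 1)"

definition fibre_card :: "nat \<Rightarrow> (nat \<Rightarrow> nat) \<Rightarrow> nat \<Rightarrow> nat" where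
  "fibre_card n t j = card {a \<in> {1..n}. t a = j}"

text \<open>\<open>fibre_rank n t a = b\<close> says that \<open>a\<close> is the \<open>b\<close>-th element (counting from 1) of its own
  fibre under \<open>t\<close>.\<close>

definition fibre_rank :: "nat \<Rightarrow> (nat \<Rightarrow> nat) \<Rightarrow> nat \<Rightarrow> nat" where
  "fibre_rank n t a = card {a' \<in> {1..n}. t a' = t a \<and> a' \<le> a}"

text \<open>\<open>offset m j = m\<^sub>1 + \<dots> + m\<^sub>j\<^sub>-\<^sub>1\<close>, so that \<open>offset m j + i\<close> is the position of the \<open>i\<close>-th entry
  of the \<open>j\<close>-th block in a concatenation of \<open>k\<close> blocks of lengths \<open>m\<^sub>1, \<dots>, m\<^sub>k\<close>.\<close>

definition offset :: "(nat \<Rightarrow> nat) \<Rightarrow> nat \<Rightarrow> nat" where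
  "offset m j = (\<Sum>i\<in>{1..<j}. m i)"

definition substitutable ::
  "nat \<Rightarrow> nat \<Rightarrow> (nat \<Rightarrow> nat) \<Rightarrow> (nat \<Rightarrow> nat) \<Rightarrow> (nat \<Rightarrow> nat \<Rightarrow> nat) \<Rightarrow> bool" where
  "substitutable n k t m ts \<longleftrightarrow>
     t \<in> Sur n k \<and> (\<forall>j\<in>{1..k}. ts j \<in> Sur (fibre_card n t j) (m j))"

text \<open>\<open>(t; t\<^sub>1, \<dots>, t\<^sub>k)\<close> for \<open>t\<close> with source \<open>{1..n}\<close> and \<open>t\<^sub>j\<close> (the map \<open>ts j\<close>) with target
  \<open>{1..m j}\<close>.\<close>

definition subst_sur ::
  "nat \<Rightarrow> (nat \<Rightarrow> nat) \<Rightarrow> (nat \<Rightarrow> nat) \<Rightarrow> (nat \<Rightarrow> nat \<Rightarrow> nat) \<Rightarrow> (nat \<Rightarrow> nat)" where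
  "subst_sur n t m ts = (\<lambda>a \<in> {1..n}. offset m (t a) + ts (t a) (fibre_rank n t a))"

definition pair2 :: "'b \<Rightarrow> 'b \<Rightarrow> (nat \<Rightarrow> 'b)" where
  "pair2 x y = (\<lambda>j \<in> {1..2}. if j = 1 then x else y)"

text \<open>An extensional function does not determine its domain, so the operations are indexed by
  surjections together with their source and target.\<close>

definition surjections :: "(nat \<times> nat \<times> (nat \<Rightarrow> nat)) set" where
  "surjections = {(n, k, t). 1 \<le> k \<and> k \<le> n \<and> t \<in> Sur n k}"

definition surjections2 :: "(nat \<times> (nat \<Rightarrow> nat)) set" where
  "surjections2 = {(N, t). t \<in> Sur N 2}"

subsection \<open>Linear maps out of tensor products\<close>

definition linear_maps ::
  "('r, 'p) ring_scheme \<Rightarrow> ('r, 'a, 'm) module_scheme \<Rightarrow> ('r, 'b, 'n) module_scheme \<Rightarrow> ('a \<Rightarrow> 'b) set"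
  where
  "linear_maps R M N = {f \<in> carrier M \<rightarrow> carrier N.
     (\<forall>x\<in>carrier M. \<forall>y\<in>carrier M. f (x \<oplus>\<^bsub>M\<^esub> y) = f x \<oplus>\<^bsub>N\<^esub> f y) \<and>
     (\<forall>c\<in>carrier R. \<forall>x\<in>carrier M. f (c \<odot>\<^bsub>M\<^esub> x) = c \<odot>\<^bsub>N\<^esub> f x)}"

text \<open>Linear maps \<open>M\<^sub>1 \<otimes> \<dots> \<otimes> M\<^sub>k \<rightarrow> N\<close>, given by the multilinear maps
  \<open>(x\<^sub>1, \<dots>, x\<^sub>k) \<mapsto> f(x\<^sub>1 \<otimes> \<dots> \<otimes> x\<^sub>k)\<close>.\<close>

definition multilinear_maps ::
  "('r, 'p) ring_scheme \<Rightarrow> nat \<Rightarrow> (nat \<Rightarrow> ('r, 'a, 'm) module_scheme) \<Rightarrow>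
   ('r, 'b, 'n) module_scheme \<Rightarrow> ((nat \<Rightarrow> 'a) \<Rightarrow> 'b) set" where
  "multilinear_maps R k M N =
     {f \<in> (\<Pi>\<^sub>E j\<in>{1..k}. carrier (M j)) \<rightarrow>\<^sub>E carrier N.
        \<forall>j\<in>{1..k}. \<forall>x\<in>(\<Pi>\<^sub>E j\<in>{1..k}. carrier (M j)). (\<lambda>y. f (x(j := y))) \<in> linear_maps R (M j) N}"

definition bilinear_maps ::
  "('r, 'p) ring_scheme \<Rightarrow> ('r, 'a, 'm) module_scheme \<Rightarrow> ('r, 'b, 'n) module_scheme \<Rightarrow>
   ('r, 'c, 'o) module_scheme \<Rightarrow> ('a \<Rightarrow> 'b \<Rightarrow> 'c) set" where
  "bilinear_maps R A B C =
     {f \<in> carrier A \<rightarrow>\<^sub>E (carrier B \<rightarrow>\<^sub>E carrier C).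
        (\<forall>x\<in>carrier A. f x \<in> linear_maps R B C) \<and>
        (\<forall>y\<in>carrier B. (\<lambda>x. f x y) \<in> linear_maps R A C)}"

subsection \<open>Permutads\<close>

text \<open>\<open>P n\<close> is the component of arity \<open>n\<close>; its value at \<open>n = 0\<close> is irrelevant.  The last two
  assumptions say \<open>P\<^sub>1 = \<bbbK> id\<close>: the unit \<open>\<bbbK> \<rightarrow> P\<^sub>1\<close>, \<open>c \<mapsto> c id\<close>, is an isomorphism.\<close>

locale unital_arity_graded_module = cring R for R :: "('r, 'p) ring_scheme" (structure) +
  fixes P :: "nat \<Rightarrow> ('r, 'a, 'm) module_scheme"
    and ident :: 'a
  assumes component_module: "1 \<le> n \<Longrightarrow> module R (P n)"
    and ident_closed: "ident \<in> carrier (P 1)"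
    and unit_iso: "bij_betw (\<lambda>c. c \<odot>\<^bsub>P 1\<^esub> ident) (carrier R) (carrier (P 1))"

text \<open>In the last clause, \<open>L (offset m j + i)\<close> is the argument \<open>\<lambda>\<^sup>j\<^sub>i\<close>.\<close>

definition permutad ::
  "('r, 'p) ring_scheme \<Rightarrow> (nat \<Rightarrow> ('r, 'a, 'm) module_scheme) \<Rightarrow> 'a \<Rightarrow>
   (nat \<times> nat \<times> (nat \<Rightarrow> nat) \<Rightarrow> (nat \<Rightarrow> 'a) \<Rightarrow> 'a) \<Rightarrow> bool" where
  "permutad R P ident \<Gamma> \<longleftrightarrow>
     unital_arity_graded_module R P ident \<and>
     \<Gamma> \<in> (\<Pi>\<^sub>E (n, k, t)\<in>surjections.
            multilinear_maps R k (\<lambda>j. P (fibre_card n t j + 1)) (P (n + 1))) \<and>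
     (\<forall>n\<ge>1. \<forall>\<mu>\<in>carrier (P (n + 1)). \<Gamma> (n, 1, corolla (n + 1)) (\<lambda>j\<in>{1..1}. \<mu>) = \<mu>) \<and>
     (\<forall>n k t m ts. 1 \<le> k \<longrightarrow> k \<le> n \<longrightarrow> substitutable n k t m ts \<longrightarrow>
        (\<forall>L \<in> (\<Pi>\<^sub>E p\<in>{1..\<Sum>j\<in>{1..k}. m j}. carrier (P (fibre_card n (subst_sur n t m ts) p + 1))).
           \<Gamma> (n, \<Sum>j\<in>{1..k}. m j, subst_sur n t m ts) L =
           \<Gamma> (n, k, t) (\<lambda>j\<in>{1..k}.
             \<Gamma> (fibre_card n t j, m j, ts j) (\<lambda>i\<in>{1..m j}. L (offset m j + i)))))"

text \<open>\<open>op (N, t) \<mu> \<nu>\<close> is \<open>\<mu> \<circ>\<^sub>t \<nu>\<close> for a surjection \<open>t\<close> from \<open>{1..N}\<close> onto \<open>{1..2}\<close>; here \<open>\<nu>\<close>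
  sits over \<open>1\<close> and \<open>\<mu>\<close> over \<open>2\<close>.  The last clause is \<open>(\<lambda> \<circ>\<^sub>s \<mu>) \<circ>\<^sub>t \<nu> = \<lambda> \<circ>\<^sub>u (\<mu> \<circ>\<^sub>v \<nu>)\<close>.\<close>

definition partial_permutad ::
  "('r, 'p) ring_scheme \<Rightarrow> (nat \<Rightarrow> ('r, 'a, 'm) module_scheme) \<Rightarrow> 'a \<Rightarrow>
   (nat \<times> (nat \<Rightarrow> nat) \<Rightarrow> 'a \<Rightarrow> 'a \<Rightarrow> 'a) \<Rightarrow> bool" where
  "partial_permutad R P ident op \<longleftrightarrow>
     unital_arity_graded_module R P ident \<and>
     op \<in> (\<Pi>\<^sub>E (N, t)\<in>surjections2.
            bilinear_maps R (P (fibre_card N t 2 + 1)) (P (fibre_card N t 1 + 1)) (P (N + 1))) \<and>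
     (\<forall>N r n m l s t u v.
        r \<in> Sur N 3 \<longrightarrow>
        n = fibre_card N r 1 \<longrightarrow> m = fibre_card N r 2 \<longrightarrow> l = fibre_card N r 3 \<longrightarrow>
        substitutable N 2 t (pair2 1 2) (pair2 (corolla (n + 1)) s) \<longrightarrow>
        subst_sur N t (pair2 1 2) (pair2 (corolla (n + 1)) s) = r \<longrightarrow>
        substitutable N 2 u (pair2 2 1) (pair2 v (corolla (l + 1))) \<longrightarrow>
        subst_sur N u (pair2 2 1) (pair2 v (corolla (l + 1))) = r \<longrightarrow>
        (\<forall>lam\<in>carrier (P (l + 1)). \<forall>\<mu>\<in>carrier (P (m + 1)). \<forall>\<nu>\<in>carrier (P (n + 1)).
           op (N, t) (op (m + l, s) lam \<mu>) \<nu> = op (N, u) lam (op (n + m, v) \<mu> \<nu>)))"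

text \<open>\<open>\<mu> \<circ>\<^sub>t \<nu> = \<Gamma>(t; \<nu>, \<mu>)\<close>\<close>

definition partial_ops ::
  "(nat \<Rightarrow> ('r, 'a, 'm) module_scheme) \<Rightarrow> (nat \<times> nat \<times> (nat \<Rightarrow> nat) \<Rightarrow> (nat \<Rightarrow> 'a) \<Rightarrow> 'a) \<Rightarrow>
   (nat \<times> (nat \<Rightarrow> nat) \<Rightarrow> 'a \<Rightarrow> 'a \<Rightarrow> 'a)" where
  "partial_ops P \<Gamma> = (\<lambda>(N, t)\<in>surjections2.
     \<lambda>\<mu>\<in>carrier (P (fibre_card N t 2 + 1)). \<lambda>\<nu>\<in>carrier (P (fibre_card N t 1 + 1)).
       \<Gamma> (N, 2, t) (pair2 \<nu> \<mu>))"

end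

theory Submission
  imports Defs
begin

text \<open>
  A surjection \<open>t\<close> onto \<open>{1..k}\<close> is the same as the ordered partition of its source into the fibres
  \<open>F\<^sub>1, \<dots>, F\<^sub>k\<close>, and only the relative order of the elements matters.  So a partial operation is a
  product of two elements labelled by disjoint finite sets of natural numbers, invariant under
  order-preserving relabelling, and \<open>(\<diamondsuit>)\<close> says exactly that this product is associative.  Hence \<open>\<Gamma> t\<close>
  must be the iterated product over the fibres.  Conversely, substitution of surjections becomes
  concatenation of lists of fibres, so that the compatibility axiom for the iterated product is
  generalized associativity.
\<close>


text \<open>The obstacle is that the inner maps of a substitution have source
  \<open>{1..fibre_card n t j}\<close>, while the sets to be concatenated are fibres inside
  \<open>{1..n}\<close>. Lists of labelled sets keep every fibre inside the one ambient set
  \<open>{1..n}\<close>, so that substitution is literally \<open>concat\<close>; the passage to an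
  inner map is the increasing map \<open>rank_in (fibre n t j)\<close>, and invariance under
  relabelling absorbs it. Associativity is what (\<diamondsuit>) says because a map \<open>r\<close>
  with fibres A, B, C has exactly two coarsenings to a map with target 2 that keep the order of the
  fibres: A against B \<union> C, and A \<union> B against C. Surjectivity means that all these sets
  are nonempty, and this condition is carried through every product. Since \<mu> \<circ> \<nu>
  places \<nu> over 1 and \<mu> over 2, the arguments of a partial operation come in the reverse of
  the order of the fibres; products below are written in the order of the fibres.\<close>

declare One_nat_def [simp del]

subsection \<open>Standardization\<close>

text \<open>For finite \<open>X\<close> this restricts to the order isomorphism from
  \<open>X\<close> onto \<open>{1..card X}\<close>; \<open>fibre_rank\<close> is the case where
  \<open>X\<close> is a fibre.\<close>

definition rank_in :: "nat set \<Rightarrow> nat \<Rightarrow> nat" where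
  "rank_in X a = card {b \<in> X. b \<le> a}"

text \<open>The partial operations are indexed only by maps with source \<open>{1..N}\<close>. A
  labelling of an arbitrary finite set is brought into this form along its order
  isomorphism.\<close>

definition standardize :: "nat set \<Rightarrow> (nat \<Rightarrow> nat) \<Rightarrow> (nat \<Rightarrow> nat)" where
  "standardize X f = (\<lambda>i\<in>{1..card X}. f (the_inv_into X (rank_in X) i))"

abbreviation fibre :: "nat \<Rightarrow> (nat \<Rightarrow> nat) \<Rightarrow> nat \<Rightarrow> nat set" where
  "fibre n t j \<equiv> {a \<in> {1..n}. t a = j}"

lemma rank_in_strict_mono:
  assumes "finite X"
  shows "strict_mono_on X (rank_in X)"
proof (rule strict_mono_onI)
  fix a b assume "a \<in> X" "b \<in> X" "a < b"
  then have "b \<in> {c \<in> X. c \<le> b} - {c \<in> X. c \<le> a}" "{c \<in> X. c \<le> a} \<subseteq> {c \<in> X. c \<le> b}"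
    by auto
  then have "{c \<in> X. c \<le> a} \<subset> {c \<in> X. c \<le> b}" by blast
  then show "rank_in X a < rank_in X b"
    unfolding rank_in_def using assms by (intro psubset_card_mono) auto
qed

lemma rank_in_bij:
  assumes "finite X"
  shows "bij_betw (rank_in X) X {1..card X}"
proof -
  have inj: "inj_on (rank_in X) X"
    using rank_in_strict_mono[OF assms] by (rule strict_mono_on_imp_inj_on)
  have "rank_in X ` X \<subseteq> {1..card X}"
    using assms by (auto simp: rank_in_def card_gt_0_iff One_nat_def Suc_le_eq intro!: card_mono)
  moreover have "card (rank_in X ` X) = card {1..card X}"
    using inj by (simp add: card_image)
  ultimately have "rank_in X ` X = {1..card X}"
    by (intro card_subset_eq) auto
  with inj show ?thesis by (simp add: bij_betw_def)
qed

lemma rank_in_inj: "finite X \<Longrightarrow> inj_on (rank_in X) X"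
  using rank_in_bij by (auto simp: bij_betw_def)

lemma rank_in_image: "finite X \<Longrightarrow> rank_in X ` X = {1..card X}"
  using rank_in_bij by (auto simp: bij_betw_def)

lemma rank_in_range: "finite X \<Longrightarrow> a \<in> X \<Longrightarrow> rank_in X a \<in> {1..card X}"
  using rank_in_image by blast

text \<open>An increasing map preserves the comparisons that a rank counts. With
  \<open>h = rank_in X\<close>, ranks inside a subset survive the standardization of
  \<open>X\<close>.\<close>

lemma rank_in_transport:
  assumes "strict_mono_on X h" "Y \<subseteq> X" "a \<in> X"
  shows "rank_in (h ` Y) (h a) = rank_in Y a"
proof -
  have "{b \<in> h ` Y. b \<le> h a} = h ` {b \<in> Y. b \<le> a}"
    using assms strict_mono_on_less_eq[OF assms(1)] by blast
  moreover have "inj_on h {b \<in> Y. b \<le> a}"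
    using strict_mono_on_imp_inj_on[OF assms(1)] assms(2) by (auto intro: inj_on_subset)
  ultimately show ?thesis by (simp add: rank_in_def card_image)
qed

lemma rank_in_interval: "a \<in> {1..n} \<Longrightarrow> rank_in {1..n} a = a"
proof -
  assume "a \<in> {1..n}"
  then have "{b \<in> {1..n}. b \<le> a} = {1..a}" by auto
  then show ?thesis by (simp add: rank_in_def)
qed

lemma standardize_rank_in: "finite X \<Longrightarrow> a \<in> X \<Longrightarrow> standardize X f (rank_in X a) = f a"
  using rank_in_range rank_in_inj by (simp add: standardize_def the_inv_into_f_f)

text \<open>Every index is the rank of some element, so a standardization is determined by its
  values at ranks. This spares later proofs the inverse map in the definition.\<close>

lemma standardize_eqI:
  assumes "finite X" "g \<in> extensional {1..card X}" "\<And>a. a \<in> X \<Longrightarrow> g (rank_in X a) = f a"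
  shows "standardize X f = g"
proof (rule extensionalityI[of _ "{1..card X}"])
  fix i assume "i \<in> {1..card X}"
  then obtain a where "a \<in> X" "i = rank_in X a" using rank_in_image[OF assms(1)] by blast
  then show "standardize X f i = g i" using assms by (simp add: standardize_rank_in)
qed (use assms(2) in \<open>auto simp: standardize_def\<close>)

lemma standardize_extensional: "standardize X f \<in> extensional {1..card X}"
  by (simp add: standardize_def)

lemma standardize_image:
  assumes "finite X" "strict_mono_on X h" "\<And>a. a \<in> X \<Longrightarrow> f (h a) = g a"
  shows "standardize (h ` X) f = standardize X g"
proof (rule standardize_eqI)
  have "card (h ` X) = card X"
    using strict_mono_on_imp_inj_on[OF assms(2)] by (rule card_image)
  then show "standardize X g \<in> extensional {1..card (h ` X)}"
    by (simp add: standardize_extensional)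
  fix b assume "b \<in> h ` X"
  then show "standardize X g (rank_in (h ` X) b) = f b"
    using assms by (auto simp: rank_in_transport standardize_rank_in)
qed (use assms in auto)

lemma standardize_interval: "t \<in> extensional {1..n} \<Longrightarrow> standardize {1..n} t = t"
  by (rule standardize_eqI) (auto simp: rank_in_interval)

lemma standardize_cong:
  assumes "finite X" "\<And>a. a \<in> X \<Longrightarrow> f a = g a"
  shows "standardize X f = standardize X g"
  using assms by (intro standardize_eqI) (auto simp: standardize_extensional standardize_rank_in)

lemma corolla_eq_standardize: "finite X \<Longrightarrow> corolla (card X + 1) = standardize X (\<lambda>_. 1)"
  using rank_in_range by (intro standardize_eqI[symmetric]) (auto simp: corolla_def)

lemma fibre_standardize:
  assumes "finite X"
  shows "fibre (card X) (standardize X f) j = rank_in X ` {a \<in> X. f a = j}"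
proof -
  have "fibre (card X) (standardize X f) j = {i \<in> rank_in X ` X. standardize X f i = j}"
    by (simp add: rank_in_image assms)
  also have "\<dots> = rank_in X ` {a \<in> X. f a = j}"
    using assms by (auto simp: standardize_rank_in)
  finally show ?thesis .
qed

lemma fibre_card_standardize:
  assumes "finite X"
  shows "fibre_card (card X) (standardize X f) j = card {a \<in> X. f a = j}"
  unfolding fibre_card_def fibre_standardize[OF assms]
  by (rule card_image, rule inj_on_subset[OF rank_in_inj[OF assms]]) auto

lemma fibre_rank_eq: "fibre_rank n t a = rank_in (fibre n t (t a)) a"
  by (simp add: fibre_rank_def rank_in_def conj_assoc)

lemma fibre_rank_standardize:
  assumes "finite X" "a \<in> X"
  shows "fibre_rank (card X) (standardize X f) (rank_in X a) = rank_in {b \<in> X. f b = f a} a"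
  unfolding fibre_rank_eq fibre_standardize[OF assms(1)] standardize_rank_in[OF assms]
  using assms(2) by (intro rank_in_transport[OF rank_in_strict_mono[OF assms(1)]]) auto

lemma standardize_Sur:
  assumes "finite X" "f ` X = {1..k}"
  shows "standardize X f \<in> Sur (card X) k"
proof -
  have "standardize X f ` {1..card X} = {1..k}"
    unfolding rank_in_image[OF assms(1), symmetric] image_image
    using assms by (simp add: standardize_rank_in)
  then show ?thesis by (auto simp: Sur_def standardize_def)
qed

text \<open>Here \<open>f\<close> selects the block and \<open>g j\<close> the label inside block
  \<open>j\<close>. The formula holds because the rank inside a fibre is the same before and after
  standardizing. It produces both factorizations in (\<diamondsuit>) and the splitting off of a
  first fibre.\<close>

lemma
  assumes "finite X" "f ` X = {1..k}"
    and g: "\<And>j. j \<in> {1..k} \<Longrightarrow> g j ` {a \<in> X. f a = j} = {1..m j}"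
    and ts: "\<And>j. j \<in> {1..k} \<Longrightarrow> ts j = standardize {a \<in> X. f a = j} (g j)"
  shows substitutable_standardize: "substitutable (card X) k (standardize X f) m ts"
    and subst_sur_standardize: "subst_sur (card X) (standardize X f) m ts =
      standardize X (\<lambda>a. offset m (f a) + g (f a) a)"
proof -
  show "substitutable (card X) k (standardize X f) m ts"
    unfolding substitutable_def fibre_card_standardize[OF assms(1)]
    using assms(1,2) g ts by (auto simp del: atLeastAtMost_iff intro!: standardize_Sur)
  show "subst_sur (card X) (standardize X f) m ts =
      standardize X (\<lambda>a. offset m (f a) + g (f a) a)"
  proof (rule standardize_eqI[symmetric])
    fix a assume a: "a \<in> X"
    have "f a \<in> {1..k}" using assms(2) a by blast
    then show "subst_sur (card X) (standardize X f) m ts (rank_in X a) =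
        offset m (f a) + g (f a) a"
      using a assms(1) rank_in_range[OF assms(1) a]
      by (simp add: subst_sur_def standardize_rank_in fibre_rank_standardize ts)
  qed (use assms(1) in \<open>auto simp: subst_sur_def\<close>)
qed

subsection \<open>Fibres of a substitution\<close>

lemma SurD:
  assumes "t \<in> Sur n k"
  shows "t \<in> extensional {1..n}" "t ` {1..n} = {1..k}" "\<And>a. a \<in> {1..n} \<Longrightarrow> t a \<in> {1..k}"
  using assms by (auto simp: Sur_def PiE_def)

lemma Sur_le: "t \<in> Sur n k \<Longrightarrow> k \<le> n"
  using card_image_le[of "{1..n}" t] by (auto dest: SurD(2))

lemma fibre_nonempty: "t \<in> Sur n k \<Longrightarrow> j \<in> {1..k} \<Longrightarrow> fibre n t j \<noteq> {}"
proof -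
  assume "t \<in> Sur n k" "j \<in> {1..k}"
  then have "j \<in> t ` {1..n}" by (simp add: SurD(2))
  then show ?thesis by auto
qed

lemma fibre_Union:
  assumes "t \<in> Sur n k"
  shows "(\<Union>j\<in>{1..k}. fibre n t j) = {1..n}"
  using SurD(3)[OF assms] by blast

lemma Sur_one_eq:
  assumes "t \<in> Sur n 1"
  shows "t = corolla (n + 1)"
  using SurD[OF assms] by (intro extensionalityI[of _ "{1..n}"]) (auto simp: corolla_def)

lemma surjectionsI: "t \<in> Sur n k \<Longrightarrow> 1 \<le> k \<Longrightarrow> (n, k, t) \<in> surjections"
  by (simp add: surjections_def Sur_le)

lemma offset_Suc: "1 \<le> j \<Longrightarrow> offset m (Suc j) = offset m j + m j"
  by (simp add: offset_def)

lemma offset_eq_sum: "offset m (Suc k) = (\<Sum>j\<in>{1..k}. m j)"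
  by (simp add: offset_def atLeastLessThanSuc_atLeastAtMost)

lemma offset_step:
  assumes "1 \<le> i" "i < j"
  shows "offset m i + m i \<le> offset m j"
proof -
  have "offset m (Suc i) \<le> offset m j"
    unfolding offset_def using assms by (intro sum_mono2) auto
  then show ?thesis using assms by (simp add: offset_Suc)
qed

text \<open>The blocks occupy consecutive disjoint intervals, so a position determines both its
  block and its index in the block.\<close>

lemma offset_eq_iff:
  assumes "1 \<le> j" "i \<in> {1..m j}" "1 \<le> j'" "i' \<in> {1..m j'}"
  shows "offset m j + i = offset m j' + i' \<longleftrightarrow> j = j' \<and> i = i'"
proof (cases j j' rule: linorder_cases)
  case less
  then show ?thesis using offset_step[of j j' m] assms by auto
next
  case greater
  then show ?thesis using offset_step[of j' j m] assms by auto
qed auto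

lemma map_upt_shift: "map (\<lambda>i. M + i) [1..<Suc l] = [Suc M..<Suc M + l]"
  by (induction l) auto

text \<open>The combinatorial source of concatenation: reading the positions of a substitution in
  order means reading block after block. Stated for lists, because the order of the factors
  matters.\<close>

lemma map_upt_blocks:
  "map f [1..<Suc (\<Sum>j\<in>{1..k}. m j)] =
   concat (map (\<lambda>j. map (\<lambda>i. f (offset m j + i)) [1..<Suc (m j)]) [1..<Suc k])"
proof (induction k)
  case (Suc k)
  let ?M = "\<Sum>j\<in>{1..k}. m j"
  have "[1..<Suc (?M + m (Suc k))] = [1..<Suc ?M] @ map (\<lambda>i. ?M + i) [1..<Suc (m (Suc k))]"
    using upt_add_eq_append[of 1 "Suc ?M" "m (Suc k)"] map_upt_shift[of ?M "m (Suc k)"]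
    by (simp add: add.commute del: upt_Suc)
  then show ?case using Suc by (simp add: offset_eq_sum o_def)
qed simp

lemma block_cover:
  "{1..\<Sum>j\<in>{1..k}. m j} = (\<Union>j\<in>{1..k}. (\<lambda>i. offset m j + i) ` {1..m j})"
  using arg_cong[OF map_upt_blocks[of "\<lambda>x. x" m k], of set]
  by (simp add: atLeastLessThanSuc_atLeastAtMost del: upt_Suc)

lemma block_index:
  assumes "j \<in> {1..k}" "i \<in> {1..m j}"
  shows "offset m j + i \<in> {1..\<Sum>j\<in>{1..k}. m j}"
  using assms unfolding block_cover by blast

lemma subst_sur_eq_iff:
  assumes "substitutable n k t m ts" "a \<in> {1..n}" "j \<in> {1..k}" "i \<in> {1..m j}"
  shows "subst_sur n t m ts a = offset m j + i \<longleftrightarrow>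
    t a = j \<and> ts j (rank_in (fibre n t j) a) = i"
proof -
  have t: "t a \<in> {1..k}" using assms by (auto simp: substitutable_def dest: SurD)
  have "ts (t a) \<in> Sur (fibre_card n t (t a)) (m (t a))" using assms t by (auto simp: substitutable_def)
  moreover have "rank_in (fibre n t (t a)) a \<in> {1..fibre_card n t (t a)}"
    unfolding fibre_card_def using assms by (intro rank_in_range) auto
  ultimately have "ts (t a) (rank_in (fibre n t (t a)) a) \<in> {1..m (t a)}" by (rule SurD(3))
  then show ?thesis
    using offset_eq_iff[of "t a" "ts (t a) (rank_in (fibre n t (t a)) a)" m j i] assms t
    by (auto simp: subst_sur_def fibre_rank_eq)
qed

lemma subst_sur_fibre:
  assumes "substitutable n k t m ts" "j \<in> {1..k}" "i \<in> {1..m j}"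
  shows "fibre n (subst_sur n t m ts) (offset m j + i) =
    {a \<in> fibre n t j. ts j (rank_in (fibre n t j) a) = i}"
  using subst_sur_eq_iff[OF assms(1) _ assms(2,3)] by blast

text \<open>The fibre of the inner map and the corresponding fibre of the substitution differ only
  by an increasing relabelling, which products do not notice.\<close>

lemma rank_in_subst_sur_fibre:
  assumes "substitutable n k t m ts" "j \<in> {1..k}" "i \<in> {1..m j}"
  shows "fibre (fibre_card n t j) (ts j) i =
    rank_in (fibre n t j) ` fibre n (subst_sur n t m ts) (offset m j + i)"
proof -
  have "{1..fibre_card n t j} = rank_in (fibre n t j) ` fibre n t j"
    by (simp add: rank_in_image fibre_card_def)
  then show ?thesis unfolding subst_sur_fibre[OF assms] by auto
qed

lemma fibre_card_subst_sur:
  assumes "substitutable n k t m ts" "j \<in> {1..k}" "i \<in> {1..m j}"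
  shows "fibre_card n (subst_sur n t m ts) (offset m j + i) = fibre_card (fibre_card n t j) (ts j) i"
proof -
  have "inj_on (rank_in (fibre n t j)) (fibre n (subst_sur n t m ts) (offset m j + i))"
    by (rule inj_on_subset[OF rank_in_inj]) (simp, unfold subst_sur_fibre[OF assms], blast)
  then show ?thesis
    using arg_cong[OF rank_in_subst_sur_fibre[OF assms], of card]
    by (simp add: card_image) (simp add: fibre_card_def)
qed

lemma subst_sur_fibre_Union:
  assumes "substitutable n k t m ts" "j \<in> {1..k}"
  shows "(\<Union>i\<in>{1..m j}. fibre n (subst_sur n t m ts) (offset m j + i)) = fibre n t j"
proof -
  have ts: "ts j \<in> Sur (fibre_card n t j) (m j)" using assms by (auto simp: substitutable_def)
  have "ts j (rank_in (fibre n t j) a) \<in> {1..m j}" if "a \<in> fibre n t j" for a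
    using SurD(3)[OF ts] rank_in_range[OF _ that] by (simp add: fibre_card_def)
  then show ?thesis using subst_sur_fibre[OF assms] by blast
qed

lemma subst_sur_Sur:
  assumes "substitutable n k t m ts"
  shows "subst_sur n t m ts \<in> Sur n (\<Sum>j\<in>{1..k}. m j)"
proof -
  let ?s = "subst_sur n t m ts"
  have "?s a \<in> {1..\<Sum>j\<in>{1..k}. m j}" if a: "a \<in> {1..n}" for a
  proof -
    have j: "t a \<in> {1..k}" using assms a by (auto simp: substitutable_def dest: SurD)
    obtain i where "i \<in> {1..m (t a)}" "?s a = offset m (t a) + i"
      using subst_sur_fibre_Union[OF assms j] a by blast
    then show ?thesis using block_index[OF j] by simp
  qed
  moreover have "p \<in> ?s ` {1..n}" if p: "p \<in> {1..\<Sum>j\<in>{1..k}. m j}" for p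
  proof -
    obtain j i where ji: "j \<in> {1..k}" "i \<in> {1..m j}" "p = offset m j + i"
      using p unfolding block_cover by blast
    have "ts j \<in> Sur (fibre_card n t j) (m j)" using assms ji by (auto simp: substitutable_def)
    then have "fibre (fibre_card n t j) (ts j) i \<noteq> {}" using ji(2) by (rule fibre_nonempty)
    then show ?thesis
      unfolding rank_in_subst_sur_fibre[OF assms ji(1,2)] ji(3)[symmetric] by auto
  qed
  ultimately have "?s ` {1..n} = {1..\<Sum>j\<in>{1..k}. m j}" by blast
  then show ?thesis by (auto simp: Sur_def subst_sur_def)
qed

subsection \<open>Products of lists of labelled sets\<close>

lemma atLeastAtMost_1_2: "{1..2::nat} = {1, 2}"
  by auto

lemma pair2_simps [simp]:
  "pair2 x y 1 = x" "pair2 x y 2 = y" "(pair2 x y)(1 := z) = pair2 z y"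
  "(pair2 x y)(2 := z) = pair2 x z"
  by (auto simp: pair2_def fun_eq_iff)

lemma offset_1_2 [simp]: "offset m 1 = 0" "offset m 2 = m 1"
  using offset_Suc[of 1 m] by (simp_all add: offset_def numeral_2_eq_2 One_nat_def)

lemma pair2_eq_restrict: "(\<lambda>j\<in>{1..2}. h j) = pair2 (h 1) (h 2)"
  unfolding pair2_def by (rule restrict_ext) (auto simp: atLeastAtMost_1_2)

lemma pair2_PiE_iff:
  "pair2 x y \<in> (\<Pi>\<^sub>E j\<in>{1..2}. S j) \<longleftrightarrow> x \<in> S 1 \<and> y \<in> S 2"
  by (auto simp: PiE_iff atLeastAtMost_1_2) (auto simp: pair2_def)

text \<open>The swap of \<open>x\<close> and \<open>y\<close> is deliberate: \<open>op\<close> takes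
  the element over 2 first, whereas here the element on \<open>A\<close>, which lies over 1, comes
  first. The labelling is meant for disjoint \<open>A\<close> and \<open>B\<close>.\<close>

definition merge ::
  "(nat \<times> (nat \<Rightarrow> nat) \<Rightarrow> 'a \<Rightarrow> 'a \<Rightarrow> 'a) \<Rightarrow> nat set \<Rightarrow> nat set \<Rightarrow> 'a \<Rightarrow> 'a \<Rightarrow> 'a" where
  "merge op A B x y = op (card (A \<union> B), standardize (A \<union> B) (\<lambda>a. if a \<in> A then 1 else 2)) y x"

abbreviation support :: "(nat set \<times> 'a) list \<Rightarrow> nat set" where
  "support ps \<equiv> \<Union>(fst ` set ps)"

text \<open>Nested to the right, so that removing the head is splitting off the first fibre. The
  singleton case mirrors the corolla axiom; the empty list never arises, since targets have at least
  one element.\<close>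

fun list_prod ::
  "(nat \<times> (nat \<Rightarrow> nat) \<Rightarrow> 'a \<Rightarrow> 'a \<Rightarrow> 'a) \<Rightarrow> (nat set \<times> 'a) list \<Rightarrow> 'a" where
  "list_prod op [] = undefined"
| "list_prod op [p] = snd p"
| "list_prod op (p # q # ps) =
    merge op (fst p) (support (q # ps)) (snd p) (list_prod op (q # ps))"

text \<open>The lists that arise from surjections: nonempty, pairwise disjoint finite sets, each
  carrying an element whose arity exceeds the size of its set by one.\<close>

fun admissible ::
  "(nat \<Rightarrow> ('r, 'a, 'm) module_scheme) \<Rightarrow> (nat set \<times> 'a) list \<Rightarrow> bool" where
  "admissible P [] \<longleftrightarrow> True"
| "admissible P (p # ps) \<longleftrightarrow> finite (fst p) \<and> fst p \<noteq> {} \<and> snd p \<in> carrier (P (card (fst p) + 1)) \<and>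
    fst p \<inter> support ps = {} \<and> admissible P ps"

lemma list_prod_Cons:
  "ps \<noteq> [] \<Longrightarrow> list_prod op (p # ps) = merge op (fst p) (support ps) (snd p) (list_prod op ps)"
  by (cases ps) auto

lemma admissible_append:
  "admissible P (ps @ qs) \<longleftrightarrow> admissible P ps \<and> admissible P qs \<and> support ps \<inter> support qs = {}"
  by (induction ps) auto

lemma admissible_finite: "admissible P ps \<Longrightarrow> finite (support ps)"
  by (induction ps) auto

lemma admissible_nonempty: "admissible P ps \<Longrightarrow> ps \<noteq> [] \<Longrightarrow> support ps \<noteq> {}"
  by (cases ps) auto

lemma admissible_map:
  assumes "distinct js"
    and "\<And>j. j \<in> set js \<Longrightarrow> finite (F j) \<and> F j \<noteq> {} \<and> x j \<in> carrier (P (card (F j) + 1))"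
    and "\<And>i j. i \<in> set js \<Longrightarrow> j \<in> set js \<Longrightarrow> i \<noteq> j \<Longrightarrow> F i \<inter> F j = {}"
  shows "admissible P (map (\<lambda>j. (F j, x j)) js)"
  using assms
proof (induction js)
  case (Cons j js)
  have "admissible P (map (\<lambda>j. (F j, x j)) js)"
    using Cons.prems by (intro Cons.IH) auto
  moreover have "F j \<inter> F i = {}" if "i \<in> set js" for i
    using Cons.prems(1,3) that by (intro Cons.prems(3)) auto
  ultimately show ?case using Cons.prems(2)[of j] by auto
qed simp

text \<open>\<open>merge\<close> sees its sets only through a standardization, which forgets an
  increasing \<open>h\<close>.\<close>

lemma merge_image:
  assumes "finite A" "finite B" "A \<inter> B = {}" "strict_mono_on (A \<union> B) h"
  shows "merge op (h ` A) (h ` B) = merge op A B"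
proof -
  have inj: "inj_on h (A \<union> B)" using assms(4) by (rule strict_mono_on_imp_inj_on)
  have "standardize (h ` (A \<union> B)) (\<lambda>a. if a \<in> h ` A then 1 else 2) =
      standardize (A \<union> B) (\<lambda>a. if a \<in> A then 1 else 2)"
  proof (rule standardize_image)
    fix a assume "a \<in> A \<union> B"
    then have "h a \<in> h ` A \<longleftrightarrow> a \<in> A" using inj by (auto dest: inj_onD)
    then show "(if h a \<in> h ` A then 1 else 2) = (if a \<in> A then 1 else (2::nat))" by simp
  qed (use assms in auto)
  then show ?thesis
    unfolding merge_def image_Un[symmetric] card_image[OF inj] by simp
qed

lemma list_prod_image:
  assumes "admissible P ps" "strict_mono_on (support ps) h"
  shows "list_prod op (map (\<lambda>p. (h ` fst p, snd p)) ps) = list_prod op ps"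
  using assms
proof (induction ps)
  case (Cons p ps)
  show ?case
  proof (cases "ps = []")
    case False
    let ?h = "map (\<lambda>p. (h ` fst p, snd p))"
    have "strict_mono_on (support ps) h"
      using Cons.prems(2) by (rule monotone_on_subset) auto
    then have "list_prod op (?h ps) = list_prod op ps" using Cons by simp
    moreover have "support (?h ps) = h ` support ps" by (auto simp: image_Union image_image)
    moreover have "merge op (h ` fst p) (h ` support ps) = merge op (fst p) (support ps)"
      using Cons.prems by (intro merge_image admissible_finite[of P ps]) auto
    ultimately show ?thesis using False by (simp add: list_prod_Cons)
  qed simp
qed simp

lemma
  assumes "finite A" "finite B" "A \<inter> B = {}" "A \<noteq> {}" "B \<noteq> {}"
  shows shuffle_Sur:
      "standardize (A \<union> B) (\<lambda>a. if a \<in> A then 1 else 2) \<in> Sur (card (A \<union> B)) 2"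
    and shuffle_fibre_card:
      "fibre_card (card (A \<union> B)) (standardize (A \<union> B) (\<lambda>a. if a \<in> A then 1 else 2)) 1 = card A"
      "fibre_card (card (A \<union> B)) (standardize (A \<union> B) (\<lambda>a. if a \<in> A then 1 else 2)) 2 = card B"
proof -
  have "(\<lambda>a. if a \<in> A then 1 else 2) ` (A \<union> B) = {1..2::nat}"
    using assms by (auto simp: atLeastAtMost_1_2 image_iff)
  then show "standardize (A \<union> B) (\<lambda>a. if a \<in> A then 1 else 2) \<in> Sur (card (A \<union> B)) 2"
    using assms by (intro standardize_Sur) auto
  have "{a \<in> A \<union> B. (if a \<in> A then 1 else 2) = (1::nat)} = A"
    "{a \<in> A \<union> B. (if a \<in> A then 1 else 2) = (2::nat)} = B"
    using assms by auto
  then show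
    "fibre_card (card (A \<union> B)) (standardize (A \<union> B) (\<lambda>a. if a \<in> A then 1 else 2)) 1 = card A"
    "fibre_card (card (A \<union> B)) (standardize (A \<union> B) (\<lambda>a. if a \<in> A then 1 else 2)) 2 = card B"
    using assms by (simp_all add: fibre_card_standardize)
qed

lemma linear_maps_id: "(\<lambda>x. x) \<in> linear_maps R M M"
  by (simp add: linear_maps_def)

lemma linear_maps_closed: "f \<in> linear_maps R M N \<Longrightarrow> x \<in> carrier M \<Longrightarrow> f x \<in> carrier N"
  by (auto simp: linear_maps_def)

lemma linear_maps_compose:
  "f \<in> linear_maps R M N \<Longrightarrow> g \<in> linear_maps R N K \<Longrightarrow> (\<lambda>x. g (f x)) \<in> linear_maps R M K"
  by (auto simp: linear_maps_def Pi_iff)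

text \<open>Extensional operations agree with products only on carriers. The module structure on
  \<open>M\<close> keeps sums and multiples inside the carrier, so that the equation applies to them
  as well.\<close>

lemma linear_maps_cong:
  assumes "module R M" "f \<in> linear_maps R M N" "\<And>x. x \<in> carrier M \<Longrightarrow> g x = f x"
  shows "g \<in> linear_maps R M N"
proof -
  interpret module R M by fact
  show ?thesis using assms(2,3) by (auto simp: linear_maps_def Pi_iff)
qed

section \<open>Associativity and linearity of iterated products\<close>

context
  fixes R :: "('r, 'p) ring_scheme"
    and P :: "nat \<Rightarrow> ('r, 'a, 'm) module_scheme"
    and ident :: 'a and op
  assumes partial: "partial_permutad R P ident op"
begin

lemma op_bilinear:
  assumes "t \<in> Sur N 2"
  shows "op (N, t) \<in>
    bilinear_maps R (P (fibre_card N t 2 + 1)) (P (fibre_card N t 1 + 1)) (P (N + 1))"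
proof -
  have "op \<in> (\<Pi>\<^sub>E (N, t)\<in>surjections2.
    bilinear_maps R (P (fibre_card N t 2 + 1)) (P (fibre_card N t 1 + 1)) (P (N + 1)))"
    using partial by (simp add: partial_permutad_def)
  then show ?thesis using assms by (auto simp: surjections2_def dest: PiE_mem[of _ _ _ "(N, t)"])
qed

lemma op_diamond:
  assumes "r \<in> Sur N 3"
    "substitutable N 2 t (pair2 1 2) (pair2 (corolla (fibre_card N r 1 + 1)) s)"
    "subst_sur N t (pair2 1 2) (pair2 (corolla (fibre_card N r 1 + 1)) s) = r"
    "substitutable N 2 u (pair2 2 1) (pair2 v (corolla (fibre_card N r 3 + 1)))"
    "subst_sur N u (pair2 2 1) (pair2 v (corolla (fibre_card N r 3 + 1))) = r"
    "z \<in> carrier (P (fibre_card N r 3 + 1))" "y \<in> carrier (P (fibre_card N r 2 + 1))"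
    "x \<in> carrier (P (fibre_card N r 1 + 1))"
  shows "op (N, t) (op (fibre_card N r 2 + fibre_card N r 3, s) z y) x =
    op (N, u) z (op (fibre_card N r 1 + fibre_card N r 2, v) y x)"
  using partial assms unfolding partial_permutad_def by blast

lemma
  assumes "finite A" "finite B" "A \<inter> B = {}" "A \<noteq> {}" "B \<noteq> {}"
  shows merge_linear_left: "y \<in> carrier (P (card B + 1)) \<Longrightarrow>
      (\<lambda>x. merge op A B x y) \<in> linear_maps R (P (card A + 1)) (P (card (A \<union> B) + 1))"
    and merge_linear_right: "x \<in> carrier (P (card A + 1)) \<Longrightarrow>
      (\<lambda>y. merge op A B x y) \<in> linear_maps R (P (card B + 1)) (P (card (A \<union> B) + 1))"
  using op_bilinear[OF shuffle_Sur[OF assms]] unfolding shuffle_fibre_card[OF assms]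
  by (simp_all add: bilinear_maps_def merge_def eta_contract_eq)

lemma merge_closed:
  assumes "finite A" "finite B" "A \<inter> B = {}" "A \<noteq> {}" "B \<noteq> {}"
    "x \<in> carrier (P (card A + 1))" "y \<in> carrier (P (card B + 1))"
  shows "merge op A B x y \<in> carrier (P (card (A \<union> B) + 1))"
  using linear_maps_closed[OF merge_linear_left[OF assms(1-5,7)] assms(6)] .

text \<open>The condition \<open>(\<diamondsuit>)\<close> for the map \<open>r\<close> with fibres \<open>A\<close>, \<open>B\<close>, \<open>C\<close>.\<close>

lemma merge_assoc:
  assumes fin: "finite A" "finite B" "finite C"
    and disj: "A \<inter> B = {}" "A \<inter> C = {}" "B \<inter> C = {}"
    and ne: "A \<noteq> {}" "B \<noteq> {}" "C \<noteq> {}"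
    and xyz: "x \<in> carrier (P (card A + 1))" "y \<in> carrier (P (card B + 1))"
      "z \<in> carrier (P (card C + 1))"
  shows "merge op A (B \<union> C) x (merge op B C y z) = merge op (A \<union> B) C (merge op A B x y) z"
proof -
  define X where "X = A \<union> B \<union> C"
  define N where "N = card X"
  define fr :: "nat \<Rightarrow> nat" where "fr = (\<lambda>a. if a \<in> A then 1 else if a \<in> B then 2 else 3)"
  define r where "r = standardize X fr"
  define s where "s = standardize (B \<union> C) (\<lambda>a. if a \<in> B then 1 else 2)"
  define t where "t = standardize X (\<lambda>a. if a \<in> A then 1 else 2)"
  define u where "u = standardize X (\<lambda>a. if a \<in> A \<union> B then 1 else 2)"
  define v where "v = standardize (A \<union> B) (\<lambda>a. if a \<in> A then 1 else 2)"
  have finX: "finite X" using fin by (simp add: X_def)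
  have "fr ` A = {1}" "fr ` B = {2}" "fr ` C = {3}"
    using ne disj by (auto simp: fr_def)
  then have "fr ` X = {1..3}" by (auto simp: X_def image_Un)
  then have r: "r \<in> Sur N 3" unfolding r_def N_def by (intro standardize_Sur finX)
  have "{a \<in> X. fr a = 1} = A" "{a \<in> X. fr a = 2} = B" "{a \<in> X. fr a = 3} = C"
    using disj by (auto simp: X_def fr_def)
  then have fc: "fibre_card N r 1 = card A" "fibre_card N r 2 = card B" "fibre_card N r 3 = card C"
    by (simp_all add: N_def r_def fibre_card_standardize finX)
  have cards: "card A + card B = card (A \<union> B)" "card B + card C = card (B \<union> C)"
    using fin disj by (simp_all add: card_Un_disjoint)
  let ?t = "\<lambda>a. if a \<in> A then 1 else (2::nat)" and ?u = "\<lambda>a. if a \<in> A \<union> B then 1 else (2::nat)"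
  let ?s = "\<lambda>a. if a \<in> B then 1 else (2::nat)"
  have ft: "{a \<in> X. ?t a = 1} = A" "{a \<in> X. ?t a = 2} = B \<union> C"
    using disj by (auto simp: X_def)
  have fu: "{a \<in> X. ?u a = 1} = A \<union> B" "{a \<in> X. ?u a = 2} = C"
    using disj by (auto simp: X_def)
  have imt: "?t ` X = {1..2}" "?u ` X = {1..2}"
    unfolding atLeastAtMost_1_2 using ne disj by (auto simp: X_def image_iff)
  \<comment> \<open>Both hypotheses on the inner maps are checked together: the constant label on
    \<open>A\<close> standardizes to the corolla, and the label on \<open>B \<union> C\<close> to
    \<open>s\<close>.\<close>
  have "\<And>j. j \<in> {1..2} \<Longrightarrow>
      pair2 (\<lambda>_. 1) ?s j ` {a \<in> X. ?t a = j} = {1..pair2 1 2 j} \<and>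
      pair2 (corolla (card A + 1)) s j = standardize {a \<in> X. ?t a = j} (pair2 (\<lambda>_. 1) ?s j)"
    unfolding atLeastAtMost_1_2
    using ne disj fin
    by (elim insertE emptyE; simp only: ft pair2_simps corolla_eq_standardize s_def)
      (auto simp: image_iff atLeastAtMost_1_2)
  note T = conjunct1[OF this] conjunct2[OF this]
  have t_sub: "substitutable N 2 t (pair2 1 2) (pair2 (corolla (card A + 1)) s)"
    unfolding t_def N_def by (rule substitutable_standardize[OF finX imt(1) T])
  have "subst_sur N t (pair2 1 2) (pair2 (corolla (card A + 1)) s) =
      standardize X (\<lambda>a. offset (pair2 1 2) (?t a) + pair2 (\<lambda>_. 1) ?s (?t a) a)"
    unfolding t_def N_def by (rule subst_sur_standardize[OF finX imt(1) T])
  \<comment> \<open>The offset of the second block is 1, which turns the labels 1 and 2 on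
    \<open>B\<close> and \<open>C\<close> into 2 and 3.\<close>
  also have "\<dots> = r"
    unfolding r_def using disj by (intro standardize_cong finX) (auto simp: fr_def X_def)
  finally have t_eq: "subst_sur N t (pair2 1 2) (pair2 (corolla (card A + 1)) s) = r" .
  have "\<And>j. j \<in> {1..2} \<Longrightarrow>
      pair2 ?t (\<lambda>_. 1) j ` {a \<in> X. ?u a = j} = {1..pair2 2 1 j} \<and>
      pair2 v (corolla (card C + 1)) j = standardize {a \<in> X. ?u a = j} (pair2 ?t (\<lambda>_. 1) j)"
    unfolding atLeastAtMost_1_2
    using ne disj fin
    by (elim insertE emptyE; simp only: fu pair2_simps corolla_eq_standardize v_def)
      (auto simp: image_iff atLeastAtMost_1_2)
  note U = conjunct1[OF this] conjunct2[OF this]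
  have u_sub: "substitutable N 2 u (pair2 2 1) (pair2 v (corolla (card C + 1)))"
    unfolding u_def N_def by (rule substitutable_standardize[OF finX imt(2) U])
  have "subst_sur N u (pair2 2 1) (pair2 v (corolla (card C + 1))) =
      standardize X (\<lambda>a. offset (pair2 2 1) (?u a) + pair2 ?t (\<lambda>_. 1) (?u a) a)"
    unfolding u_def N_def by (rule subst_sur_standardize[OF finX imt(2) U])
  \<comment> \<open>Now the first block has two labels, so the single label on \<open>C\<close> is
    shifted by 2 and becomes 3.\<close>
  also have "\<dots> = r"
    unfolding r_def using disj by (intro standardize_cong finX) (auto simp: fr_def X_def)
  finally have u_eq: "subst_sur N u (pair2 2 1) (pair2 v (corolla (card C + 1))) = r" .
  \<comment> \<open>The \<lambda>, \<mu>, \<nu> of (\<diamondsuit>) are \<open>z\<close>,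
    \<open>y\<close>, \<open>x\<close>: the reverse of the order of the fibres.\<close>
  have "op (N, t) (op (card (B \<union> C), s) z y) x = op (N, u) z (op (card (A \<union> B), v) y x)"
    using op_diamond[OF r, unfolded fc cards, OF t_sub t_eq u_sub u_eq xyz(3,2,1)] .
  then show ?thesis by (simp add: merge_def N_def t_def u_def s_def v_def X_def Un_assoc)
qed

lemma list_prod_closed:
  "admissible P ps \<Longrightarrow> ps \<noteq> [] \<Longrightarrow> list_prod op ps \<in> carrier (P (card (support ps) + 1))"
proof (induction ps)
  case (Cons p ps)
  show ?case
  proof (cases "ps = []")
    case False
    then have "merge op (fst p) (support ps) (snd p) (list_prod op ps) \<in>
        carrier (P (card (fst p \<union> support ps) + 1))"
      using Cons by (intro merge_closed admissible_finite admissible_nonempty) auto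
    then show ?thesis using False by (simp add: list_prod_Cons)
  qed (use Cons in simp)
qed simp

text \<open>The factors to the left of the slot are stripped one by one, each contributing a
  \<open>merge\<close> that is linear in its right argument. The slot then stands at the head, where
  the product is linear in the left argument, or is the identity if nothing follows.\<close>

lemma list_prod_linear:
  assumes "admissible P ps" "admissible P qs" "finite A" "A \<noteq> {}"
    "support ps \<inter> A = {}" "support qs \<inter> A = {}" "support ps \<inter> support qs = {}"
  shows "(\<lambda>y. list_prod op (ps @ (A, y) # qs)) \<in>
    linear_maps R (P (card A + 1)) (P (card (support ps \<union> A \<union> support qs) + 1))"
  using assms
proof (induction ps)
  case Nil
  show ?case
  proof (cases "qs = []")
    case True
    then show ?thesis by (simp add: linear_maps_id)
  next
    case False
    have "(\<lambda>y. merge op A (support qs) y (list_prod op qs)) \<in>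
        linear_maps R (P (card A + 1)) (P (card (A \<union> support qs) + 1))"
      using Nil False
      by (intro merge_linear_left list_prod_closed admissible_finite admissible_nonempty) auto
    then show ?thesis using False by (simp add: list_prod_Cons)
  qed
next
  case (Cons p ps)
  let ?S = "support ps \<union> A \<union> support qs"
  have "(\<lambda>y. list_prod op (ps @ (A, y) # qs)) \<in> linear_maps R (P (card A + 1)) (P (card ?S + 1))"
    using Cons by auto
  moreover have "(\<lambda>z. merge op (fst p) ?S (snd p) z) \<in>
      linear_maps R (P (card ?S + 1)) (P (card (fst p \<union> ?S) + 1))"
    using Cons.prems by (intro merge_linear_right finite_UnI admissible_finite) auto
  ultimately have "(\<lambda>y. merge op (fst p) ?S (snd p) (list_prod op (ps @ (A, y) # qs))) \<in>
      linear_maps R (P (card A + 1)) (P (card (fst p \<union> ?S) + 1))"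
    by (rule linear_maps_compose)
  then show ?case by (simp add: list_prod_Cons Un_assoc Un_left_commute)
qed

text \<open>Generalized associativity for one cut: each head moved across the bracket costs one use
  of \<open>merge_assoc\<close>. Both parts must be nonempty for their products to have a
  meaning.\<close>

lemma list_prod_append:
  assumes "admissible P (ps @ qs)" "ps \<noteq> []" "qs \<noteq> []"
  shows "list_prod op (ps @ qs) =
    merge op (support ps) (support qs) (list_prod op ps) (list_prod op qs)"
  using assms
proof (induction ps)
  case (Cons p ps)
  show ?case
  proof (cases "ps = []")
    case True
    then show ?thesis using Cons.prems by (simp add: list_prod_Cons)
  next
    case False
    have adm: "admissible P ps" "admissible P qs" "support ps \<inter> support qs = {}"
      using Cons.prems by (auto simp: admissible_append)
    have "list_prod op (p # ps @ qs) = merge op (fst p) (support ps \<union> support qs) (snd p)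
        (merge op (support ps) (support qs) (list_prod op ps) (list_prod op qs))"
      using Cons False by (simp add: list_prod_Cons)
    also have "\<dots> = merge op (fst p \<union> support ps) (support qs)
        (merge op (fst p) (support ps) (snd p) (list_prod op ps)) (list_prod op qs)"
      using Cons.prems False adm
      by (intro merge_assoc list_prod_closed admissible_finite admissible_nonempty) auto
    finally show ?thesis using False by (simp add: list_prod_Cons)
  qed
qed simp

text \<open>Generalized associativity for many cuts: each inner list collapses to a single element
  labelled by its support. This becomes the compatibility axiom once the inner lists are the blocks
  of a substitution.\<close>

lemma list_prod_concat:
  assumes "admissible P (concat pss)" "pss \<noteq> []" "[] \<notin> set pss"
  shows "list_prod op (concat pss) = list_prod op (map (\<lambda>ps. (support ps, list_prod op ps)) pss)"
  using assms
proof (induction pss)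
  case (Cons ps pss)
  show ?case
  proof (cases "pss = []")
    case False
    then have "concat pss \<noteq> []" using Cons.prems by (cases pss) auto
    then have "list_prod op (concat (ps # pss)) = merge op (support ps) (support (concat pss))
        (list_prod op ps) (list_prod op (concat pss))"
      using Cons.prems list_prod_append[of ps "concat pss"]
      unfolding concat.simps set_simps insert_iff by blast
    moreover have "support (map (\<lambda>ps. (support ps, list_prod op ps)) pss) = support (concat pss)"
      by auto
    ultimately show ?thesis
      using Cons False by (simp add: list_prod_Cons admissible_append del: set_concat set_map)
  qed simp
qed simp

end

subsection \<open>Total operations from partial ones\<close>

definition blocks :: "nat \<Rightarrow> nat \<Rightarrow> (nat \<Rightarrow> nat) \<Rightarrow> (nat \<Rightarrow> 'a) \<Rightarrow> (nat set \<times> 'a) list" where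
  "blocks n k t L = map (\<lambda>j. (fibre n t j, L j)) [1..<Suc k]"

definition total_ops ::
  "(nat \<Rightarrow> ('r, 'a, 'm) module_scheme) \<Rightarrow> (nat \<times> (nat \<Rightarrow> nat) \<Rightarrow> 'a \<Rightarrow> 'a \<Rightarrow> 'a) \<Rightarrow>
   (nat \<times> nat \<times> (nat \<Rightarrow> nat) \<Rightarrow> (nat \<Rightarrow> 'a) \<Rightarrow> 'a)" where
  "total_ops P op = (\<lambda>(n, k, t)\<in>surjections.
     \<lambda>L\<in>(\<Pi>\<^sub>E j\<in>{1..k}. carrier (P (fibre_card n t j + 1))). list_prod op (blocks n k t L))"

lemma blocks_admissible:
  assumes "t \<in> Sur n k" "L \<in> (\<Pi> j\<in>{1..k}. carrier (P (fibre_card n t j + 1)))"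
  shows "admissible P (blocks n k t L)"
  unfolding blocks_def
proof (rule admissible_map)
  fix j assume "j \<in> set [1..<Suc k]"
  then have j: "j \<in> {1..k}" by auto
  show "finite (fibre n t j) \<and> fibre n t j \<noteq> {} \<and> L j \<in> carrier (P (card (fibre n t j) + 1))"
    using assms(2) j fibre_nonempty[OF assms(1) j] by (auto simp: fibre_card_def)
qed auto

lemma blocks_1: "blocks n 1 t L = [(fibre n t 1, L 1)]"
  by (simp add: blocks_def One_nat_def)

lemma blocks_2: "blocks n 2 t L = [(fibre n t 1, L 1), (fibre n t 2, L 2)]"
  by (simp add: blocks_def One_nat_def numeral_2_eq_2)

lemma blocks_not_Nil: "1 \<le> k \<Longrightarrow> blocks n k t L \<noteq> []"
  by (simp add: blocks_def)

lemma blocks_support: "t \<in> Sur n k \<Longrightarrow> support (blocks n k t L) = {1..n}"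
  using fibre_Union[of t n k]
  by (simp add: blocks_def image_image atLeastLessThanSuc_atLeastAtMost del: upt_Suc)

lemma total_ops_apply:
  assumes "t \<in> Sur n k" "1 \<le> k" "L \<in> (\<Pi>\<^sub>E j\<in>{1..k}. carrier (P (fibre_card n t j + 1)))"
  shows "total_ops P op (n, k, t) L = list_prod op (blocks n k t L)"
  using assms surjectionsI[OF assms(1,2)] by (simp add: total_ops_def)

lemma Sur_source_pos: "t \<in> Sur n k \<Longrightarrow> 1 \<le> k \<Longrightarrow> 1 \<le> n"
  using Sur_le by fastforce

section \<open>The iterated product as a permutad structure extending the partial operations\<close>

context
  fixes R :: "('r, 'p) ring_scheme"
    and P :: "nat \<Rightarrow> ('r, 'a, 'm) module_scheme"
    and ident :: 'a and op
  assumes partial: "partial_permutad R P ident op"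
begin

lemma component: "1 \<le> n \<Longrightarrow> module R (P n)"
  using unital_arity_graded_module.component_module
    [OF conjunct1[OF partial[unfolded partial_permutad_def]]] .

lemma list_prod_blocks_closed:
  assumes "t \<in> Sur n k" "1 \<le> k" "L \<in> (\<Pi> j\<in>{1..k}. carrier (P (fibre_card n t j + 1)))"
  shows "list_prod op (blocks n k t L) \<in> carrier (P (n + 1))"
  using list_prod_closed[OF partial blocks_admissible[OF assms(1,3)] blocks_not_Nil[OF assms(2)]]
  unfolding blocks_support[OF assms(1)] by simp

lemma total_ops_multilinear:
  assumes t: "t \<in> Sur n k" and k: "1 \<le> k"
  shows "total_ops P op (n, k, t) \<in>
    multilinear_maps R k (\<lambda>j. P (fibre_card n t j + 1)) (P (n + 1))"
proof -
  let ?D = "\<Pi>\<^sub>E j\<in>{1..k}. carrier (P (fibre_card n t j + 1))"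
  have "total_ops P op (n, k, t) \<in> ?D \<rightarrow>\<^sub>E carrier (P (n + 1))"
  proof (rule PiE_I)
    fix L assume L: "L \<in> ?D"
    then show "total_ops P op (n, k, t) L \<in> carrier (P (n + 1))"
      unfolding total_ops_apply[OF t k L] by (intro list_prod_blocks_closed t k) (simp add: PiE_def)
  qed (use surjectionsI[OF t k] in \<open>simp add: total_ops_def\<close>)
  moreover have "(\<lambda>y. total_ops P op (n, k, t) (L(j := y))) \<in>
      linear_maps R (P (fibre_card n t j + 1)) (P (n + 1))"
    if j: "j \<in> {1..k}" and L: "L \<in> ?D" for j L
  proof (rule linear_maps_cong)
    let ?F = "\<lambda>i. (fibre n t i, L i)"
    let ?ps = "map ?F [1..<j]" and ?qs = "map ?F [Suc j..<Suc k]"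
    have "[1..<Suc k] = [1..<j] @ j # [Suc j..<Suc k]"
      using j upt_add_eq_append[of 1 j "Suc k - j"] by (simp add: upt_conv_Cons del: upt_Suc)
    then have split: "blocks n k t (L(j := y)) = ?ps @ (fibre n t j, y) # ?qs" for y
      by (simp add: blocks_def del: upt_Suc)
    from L j have upd: "L(j := y) \<in> ?D" if "y \<in> carrier (P (fibre_card n t j + 1))" for y
      using that by (auto simp: PiE_iff extensional_def)
    show "total_ops P op (n, k, t) (L(j := y)) = list_prod op (?ps @ (fibre n t j, y) # ?qs)"
      if "y \<in> carrier (P (fibre_card n t j + 1))" for y
      using total_ops_apply[OF t k upd[OF that], of op] unfolding split .
    \<comment> \<open>The update is trivial; this form lets \<open>split\<close> rewrite the list
      around the slot \<open>j\<close>.\<close>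
    have "admissible P (blocks n k t (L(j := L j)))"
      using L by (intro blocks_admissible t) (simp add: PiE_def)
    then have adm: "admissible P (?ps @ (fibre n t j, L j) # ?qs)" unfolding split .
    have sup: "support ?ps \<union> fibre n t j \<union> support ?qs = {1..n}"
      using blocks_support[OF t, of "L(j := L j)"] unfolding split
      by (simp add: Un_assoc Un_left_commute del: upt_Suc)
    have "(\<lambda>y. list_prod op (?ps @ (fibre n t j, y) # ?qs)) \<in> linear_maps R
        (P (card (fibre n t j) + 1)) (P (card (support ?ps \<union> fibre n t j \<union> support ?qs) + 1))"
      using adm unfolding admissible_append
      by (intro list_prod_linear[OF partial]) auto
    then show "(\<lambda>y. list_prod op (?ps @ (fibre n t j, y) # ?qs)) \<in>
        linear_maps R (P (fibre_card n t j + 1)) (P (n + 1))"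
      unfolding sup by (simp add: fibre_card_def)
  qed (simp add: component)
  ultimately show ?thesis by (simp add: multilinear_maps_def)
qed

text \<open>The list for the substitution is the concatenation of sublists, one for each fibre of
  \<open>t\<close>. The product of a sublist equals the inner operation by relabelling, and
  \<open>list_prod_concat\<close> assembles these products into the outer one.\<close>

lemma total_ops_subst:
  assumes k: "1 \<le> k" and sub: "substitutable n k t m ts"
    and L: "L \<in> (\<Pi>\<^sub>E p\<in>{1..\<Sum>j\<in>{1..k}. m j}.
      carrier (P (fibre_card n (subst_sur n t m ts) p + 1)))"
  shows "total_ops P op (n, \<Sum>j\<in>{1..k}. m j, subst_sur n t m ts) L =
    total_ops P op (n, k, t) (\<lambda>j\<in>{1..k}.
      total_ops P op (fibre_card n t j, m j, ts j) (\<lambda>i\<in>{1..m j}. L (offset m j + i)))"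
proof -
  let ?s = "subst_sur n t m ts" and ?M = "\<Sum>j\<in>{1..k}. m j"
  let ?L = "\<lambda>j. \<lambda>i\<in>{1..m j}. L (offset m j + i)"
  let ?B = "\<lambda>j. map (\<lambda>i. (fibre n ?s (offset m j + i), L (offset m j + i))) [1..<Suc (m j)]"
  have t: "t \<in> Sur n k" using sub by (simp add: substitutable_def)
  have s: "?s \<in> Sur n ?M" using sub by (rule subst_sur_Sur)
  have ts: "ts j \<in> Sur (fibre_card n t j) (m j)" if "j \<in> {1..k}" for j
    using sub that by (simp add: substitutable_def)
  \<comment> \<open>The fibre is nonempty, so \<open>ts j\<close> has a value at 1, and this value
    lies in \<open>{1..m j}\<close>.\<close>
  have m: "1 \<le> m j" if "j \<in> {1..k}" for j
  proof -
    have "fibre_card n t j \<noteq> 0"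
      using fibre_nonempty[OF t that] by (simp add: fibre_card_def card_eq_0_iff)
    then show ?thesis using SurD(3)[OF ts[OF that], of 1] by auto
  qed
  have m0: "m j \<noteq> 0" if "1 \<le> j" "j < Suc k" for j using m[of j] that by simp
  have "m 1 \<le> ?M" using k by (intro member_le_sum) auto
  then have M: "1 \<le> ?M" using m[of 1] k by simp
  have concat: "blocks n ?M ?s L = concat (map ?B [1..<Suc k])"
    unfolding blocks_def by (rule map_upt_blocks)
  have adm: "admissible P (blocks n ?M ?s L)"
    using L by (intro blocks_admissible s) (simp add: PiE_def)
  have LB: "?L j \<in> (\<Pi>\<^sub>E i\<in>{1..m j}. carrier (P (fibre_card (fibre_card n t j) (ts j) i + 1)))"
    if j: "j \<in> {1..k}" for j
  proof (rule PiE_I)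
    fix i assume i: "i \<in> {1..m j}"
    then show "?L j i \<in> carrier (P (fibre_card (fibre_card n t j) (ts j) i + 1))"
      using PiE_mem[OF L block_index[OF j, of i m]] by (simp add: fibre_card_subst_sur[OF sub j i])
  qed auto
  have supp: "support (?B j) = fibre n t j" if "j \<in> {1..k}" for j
    using subst_sur_fibre_Union[OF sub that]
    by (simp add: image_image atLeastLessThanSuc_atLeastAtMost del: upt_Suc)
  \<comment> \<open>A contiguous part of an admissible list is admissible.\<close>
  have admB: "admissible P (?B j)" if j: "j \<in> {1..k}" for j
  proof -
    have "[1..<Suc k] = [1..<j] @ j # [Suc j..<Suc k]"
      using j upt_add_eq_append[of 1 j "Suc k - j"] by (simp add: upt_conv_Cons del: upt_Suc)
    then show ?thesis using adm unfolding concat by (simp add: admissible_append del: upt_Suc)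
  qed
  have inner: "total_ops P op (fibre_card n t j, m j, ts j) (?L j) = list_prod op (?B j)"
    if j: "j \<in> {1..k}" for j
  proof -
    have "total_ops P op (fibre_card n t j, m j, ts j) (?L j) =
        list_prod op (blocks (fibre_card n t j) (m j) (ts j) (?L j))"
      by (rule total_ops_apply[OF ts[OF j] m[OF j] LB[OF j]])
    \<comment> \<open>The inner map lives on ranks, the sublist on elements of
      \<open>{1..n}\<close>; the entries are the same and the sets correspond under
      \<open>rank_in\<close>.\<close>
    also have "blocks (fibre_card n t j) (m j) (ts j) (?L j) =
        map (\<lambda>p. (rank_in (fibre n t j) ` fst p, snd p)) (?B j)"
      unfolding blocks_def map_map
    proof (rule map_cong[OF refl])
      fix i assume "i \<in> set [1..<Suc (m j)]"
      then have i: "i \<in> {1..m j}" by auto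
      then show "(fibre (fibre_card n t j) (ts j) i, ?L j i) =
          ((\<lambda>p. (rank_in (fibre n t j) ` fst p, snd p)) \<circ>
           (\<lambda>i. (fibre n ?s (offset m j + i), L (offset m j + i)))) i"
        using rank_in_subst_sur_fibre[OF sub j i] by simp
    qed
    also have "list_prod op \<dots> = list_prod op (?B j)"
    proof (rule list_prod_image[OF admB[OF j]])
      show "strict_mono_on (support (?B j)) (rank_in (fibre n t j))"
        unfolding supp[OF j] by (rule rank_in_strict_mono) simp
    qed
    finally show ?thesis .
  qed
  have closed: "list_prod op (?B j) \<in> carrier (P (fibre_card n t j + 1))" if j: "j \<in> {1..k}" for j
    using list_prod_closed[OF partial admB[OF j]] m[OF j] unfolding supp[OF j]
    by (simp add: fibre_card_def)
  let ?K = "\<lambda>j\<in>{1..k}. list_prod op (?B j)"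
  have K: "?K \<in> (\<Pi>\<^sub>E j\<in>{1..k}. carrier (P (fibre_card n t j + 1)))"
    using closed by auto
  have "total_ops P op (n, ?M, ?s) L = list_prod op (concat (map ?B [1..<Suc k]))"
    using total_ops_apply[OF s M L] by (simp only: concat)
  also have "\<dots> = list_prod op (map (\<lambda>ps. (support ps, list_prod op ps)) (map ?B [1..<Suc k]))"
    using adm k unfolding concat
    by (intro list_prod_concat[OF partial]) (auto simp del: upt_Suc dest: m0)
  also have "map (\<lambda>ps. (support ps, list_prod op ps)) (map ?B [1..<Suc k]) = blocks n k t ?K"
    unfolding blocks_def map_map
  proof (rule map_cong[OF refl])
    fix j assume "j \<in> set [1..<Suc k]"
    then have j: "j \<in> {1..k}" by auto
    then show "((\<lambda>ps. (support ps, list_prod op ps)) \<circ> ?B) j = (fibre n t j, ?K j)"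
      using supp[OF j] by (simp del: upt_Suc set_map set_upt)
  qed
  also have "list_prod op (blocks n k t ?K) = total_ops P op (n, k, t) ?K"
    by (rule total_ops_apply[OF t k K, symmetric])
  also have "?K = (\<lambda>j\<in>{1..k}. total_ops P op (fibre_card n t j, m j, ts j) (?L j))"
    by (rule restrict_ext) (rule inner[symmetric])
  finally show ?thesis .
qed

lemma permutad_total_ops: "permutad R P ident (total_ops P op)"
  unfolding permutad_def
proof (intro conjI allI impI ballI)
  show "unital_arity_graded_module R P ident" using partial by (simp add: partial_permutad_def)
  show "total_ops P op \<in> (\<Pi>\<^sub>E (n, k, t)\<in>surjections.
      multilinear_maps R k (\<lambda>j. P (fibre_card n t j + 1)) (P (n + 1)))"
  proof (rule PiE_I)
    fix x assume "x \<in> surjections"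
    then show "total_ops P op x \<in> (case x of (n, k, t) \<Rightarrow>
        multilinear_maps R k (\<lambda>j. P (fibre_card n t j + 1)) (P (n + 1)))"
      using total_ops_multilinear by (auto simp: surjections_def)
  qed (simp add: total_ops_def)
  fix n :: nat and \<mu>
  assume n: "1 \<le> n" and \<mu>: "\<mu> \<in> carrier (P (n + 1))"
  have t: "corolla (n + 1) \<in> Sur n 1" using n by (auto simp: Sur_def corolla_def)
  have fib: "fibre n (corolla (n + 1)) 1 = {1..n}" by (auto simp: corolla_def)
  have "total_ops P op (n, 1, corolla (n + 1)) (\<lambda>j\<in>{1..1}. \<mu>) =
      list_prod op (blocks n 1 (corolla (n + 1)) (\<lambda>j\<in>{1..1}. \<mu>))"
    using \<mu> fib by (intro total_ops_apply t) (simp_all add: fibre_card_def del: atLeastAtMost_iff)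
  then show "total_ops P op (n, 1, corolla (n + 1)) (\<lambda>j\<in>{1..1}. \<mu>) = \<mu>"
    by (simp add: blocks_1)
qed (rule total_ops_subst)

lemma partial_ops_total_ops: "partial_ops P (total_ops P op) = op"
proof (rule ext)
  fix x
  have op: "op \<in> extensional surjections2"
    using partial by (auto simp: partial_permutad_def PiE_def)
  show "partial_ops P (total_ops P op) x = op x"
  proof (cases "x \<in> surjections2")
    case False
    then show ?thesis using extensional_arb[OF op False] by (simp add: partial_ops_def)
  next
    case True
    then obtain N t where x: "x = (N, t)" and t: "t \<in> Sur N 2" by (auto simp: surjections2_def)
    let ?C = "\<lambda>i. carrier (P (fibre_card N t i + 1))"
    have A: "fibre N t 1 \<union> fibre N t 2 = {1..N}"
      using fibre_Union[OF t] by (simp add: atLeastAtMost_1_2)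
    \<comment> \<open>With target 2, the fibre over 1 determines \<open>t\<close>; on the full
      interval standardization then changes nothing, so \<open>merge\<close> returns
      \<open>op (N, t)\<close> itself.\<close>
    have "standardize {1..N} (\<lambda>a. if a \<in> fibre N t 1 then 1 else 2) = standardize {1..N} t"
      using SurD(3)[OF t] by (intro standardize_cong) (auto simp: atLeastAtMost_1_2)
    then have std: "standardize {1..N} (\<lambda>a. if a \<in> fibre N t 1 then 1 else 2) = t"
      using standardize_interval[OF SurD(1)[OF t]] by simp
    have eq: "total_ops P op (N, 2, t) (pair2 \<nu> \<mu>) = op (N, t) \<mu> \<nu>"
      if "\<mu> \<in> ?C 2" "\<nu> \<in> ?C 1" for \<mu> \<nu>
    proof -
      have "total_ops P op (N, 2, t) (pair2 \<nu> \<mu>) = list_prod op (blocks N 2 t (pair2 \<nu> \<mu>))"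
        using that by (intro total_ops_apply t) (simp_all add: pair2_PiE_iff)
      also have "\<dots> = merge op (fibre N t 1) (fibre N t 2) \<nu> \<mu>"
        by (simp add: blocks_2)
      also have "\<dots> = op (N, t) \<mu> \<nu>" unfolding merge_def A std by simp
      finally show ?thesis .
    qed
    have "op (N, t) \<in> extensional (?C 2)" "\<And>\<mu>. \<mu> \<in> ?C 2 \<Longrightarrow> op (N, t) \<mu> \<in> extensional (?C 1)"
      using op_bilinear[OF partial t] by (auto simp: bilinear_maps_def PiE_def)
    moreover have "partial_ops P (total_ops P op) (N, t) =
        (\<lambda>\<mu>\<in>?C 2. \<lambda>\<nu>\<in>?C 1. total_ops P op (N, 2, t) (pair2 \<nu> \<mu>))"
      using True x by (simp add: partial_ops_def)
    ultimately show ?thesis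
      unfolding x by (auto simp: fun_eq_iff eq restrict_def extensional_def)
  qed
qed

end

subsection \<open>Partial operations from total ones\<close>

context
  fixes R :: "('r, 'p) ring_scheme"
    and P :: "nat \<Rightarrow> ('r, 'a, 'm) module_scheme"
    and ident :: 'a and \<Gamma>
  assumes total: "permutad R P ident \<Gamma>"
begin

lemma total_component: "1 \<le> n \<Longrightarrow> module R (P n)"
  using unital_arity_graded_module.component_module
    [OF conjunct1[OF total[unfolded permutad_def]]] .

lemma total_multilinear:
  assumes "t \<in> Sur n k" "1 \<le> k"
  shows "\<Gamma> (n, k, t) \<in> multilinear_maps R k (\<lambda>j. P (fibre_card n t j + 1)) (P (n + 1))"
proof -
  have "\<Gamma> \<in> (\<Pi>\<^sub>E (n, k, t)\<in>surjections.
      multilinear_maps R k (\<lambda>j. P (fibre_card n t j + 1)) (P (n + 1)))"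
    using total by (simp add: permutad_def)
  then show ?thesis using PiE_mem[OF _ surjectionsI[OF assms]] by fastforce
qed

lemma total_closed:
  assumes "t \<in> Sur n k" "1 \<le> k" "L \<in> (\<Pi>\<^sub>E j\<in>{1..k}. carrier (P (fibre_card n t j + 1)))"
  shows "\<Gamma> (n, k, t) L \<in> carrier (P (n + 1))"
  using total_multilinear[OF assms(1,2)] assms(3) by (auto simp: multilinear_maps_def)

lemma total_corolla: "1 \<le> n \<Longrightarrow> \<mu> \<in> carrier (P (n + 1)) \<Longrightarrow>
    \<Gamma> (n, 1, corolla (n + 1)) (\<lambda>j\<in>{1..1}. \<mu>) = \<mu>"
  using total by (simp add: permutad_def)

text \<open>Compatibility for an outer map with target 2, the only case used to recover \<Gamma>
  from its partial operations. The second block starts after position \<open>p\<close>.\<close>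

lemma total_subst_pair:
  assumes "substitutable n 2 t (pair2 p q) (pair2 t1 t2)"
    and "subst_sur n t (pair2 p q) (pair2 t1 t2) = r"
    and "L \<in> (\<Pi>\<^sub>E j\<in>{1..p + q}. carrier (P (fibre_card n r j + 1)))"
  shows "\<Gamma> (n, p + q, r) L = \<Gamma> (n, 2, t) (pair2
    (\<Gamma> (fibre_card n t 1, p, t1) (\<lambda>i\<in>{1..p}. L i))
    (\<Gamma> (fibre_card n t 2, q, t2) (\<lambda>i\<in>{1..q}. L (p + i))))"
proof -
  have sum: "(\<Sum>j\<in>{1..2}. pair2 p q j) = p + q" by (simp add: atLeastAtMost_1_2)
  have "2 \<le> n" using assms(1) Sur_le by (auto simp: substitutable_def)
  then show ?thesis
    using total[unfolded permutad_def, THEN conjunct2, THEN conjunct2, THEN conjunct2, rule_format,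
        OF _ _ assms(1), of L] assms(3)
    unfolding assms(2) sum pair2_eq_restrict by simp
qed

lemma partial_ops_apply:
  assumes "t \<in> Sur N 2" "\<mu> \<in> carrier (P (fibre_card N t 2 + 1))"
    "\<nu> \<in> carrier (P (fibre_card N t 1 + 1))"
  shows "partial_ops P \<Gamma> (N, t) \<mu> \<nu> = \<Gamma> (N, 2, t) (pair2 \<nu> \<mu>)"
  using assms by (simp add: partial_ops_def surjections2_def)

lemma partial_ops_bilinear:
  assumes t: "t \<in> Sur N 2"
  shows "partial_ops P \<Gamma> (N, t) \<in>
    bilinear_maps R (P (fibre_card N t 2 + 1)) (P (fibre_card N t 1 + 1)) (P (N + 1))"
proof -
  let ?M = "\<lambda>i. P (fibre_card N t i + 1)"
  have lin: "(\<lambda>y. \<Gamma> (N, 2, t) ((pair2 \<nu> \<mu>)(j := y))) \<in> linear_maps R (?M j) (P (N + 1))"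
    if "\<mu> \<in> carrier (?M 2)" "\<nu> \<in> carrier (?M 1)" "j \<in> {1..2}" for \<mu> \<nu> j
  proof -
    have "pair2 \<nu> \<mu> \<in> (\<Pi>\<^sub>E j\<in>{1..2}. carrier (?M j))" using that by (simp add: pair2_PiE_iff)
    then show ?thesis using total_multilinear[OF t] that(3) by (simp add: multilinear_maps_def)
  qed
  \<comment> \<open>Multilinearity is stated at a complete tuple, so the slot being varied needs
    some initial entry; zero serves.\<close>
  have "\<zero>\<^bsub>?M i\<^esub> \<in> carrier (?M i)" for i
  proof -
    interpret module R "?M i" by (rule total_component) simp
    show ?thesis by simp
  qed
  note zero = this
  have right: "(\<lambda>\<nu>. partial_ops P \<Gamma> (N, t) \<mu> \<nu>) \<in> linear_maps R (?M 1) (P (N + 1))"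
    if \<mu>: "\<mu> \<in> carrier (?M 2)" for \<mu>
    using lin[OF \<mu> zero, of 1]
    by - (rule linear_maps_cong[where f = "\<lambda>y. \<Gamma> (N, 2, t) (pair2 y \<mu>)"],
      simp_all add: total_component partial_ops_apply t \<mu>)
  have left: "(\<lambda>\<mu>. partial_ops P \<Gamma> (N, t) \<mu> \<nu>) \<in> linear_maps R (?M 2) (P (N + 1))"
    if \<nu>: "\<nu> \<in> carrier (?M 1)" for \<nu>
    using lin[OF zero \<nu>, of 2]
    by - (rule linear_maps_cong[where f = "\<lambda>y. \<Gamma> (N, 2, t) (pair2 \<nu> y)"],
      simp_all add: total_component partial_ops_apply t \<nu>)
  have "partial_ops P \<Gamma> (N, t) \<in> carrier (?M 2) \<rightarrow>\<^sub>E (carrier (?M 1) \<rightarrow>\<^sub>E carrier (P (N + 1)))"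
    using linear_maps_closed[OF right] t
    by (auto simp: PiE_iff partial_ops_def surjections2_def)
  with right left show ?thesis by (simp add: bilinear_maps_def eta_contract_eq)
qed

text \<open>Both sides equal \<open>\<Gamma> (N, 3, r)\<close> at the triple \<open>x\<close>,
  \<open>y\<close>, \<open>z\<close>: compatibility expands it along the two factorizations of
  \<open>r\<close>, and the corolla axiom removes the unary inner operations.\<close>

lemma partial_ops_diamond:
  fixes r s t u v
  assumes r: "r \<in> Sur N 3"
    and n: "n = fibre_card N r 1" and m: "m = fibre_card N r 2" and l: "l = fibre_card N r 3"
    and t: "substitutable N 2 t (pair2 1 2) (pair2 (corolla (n + 1)) s)"
      "subst_sur N t (pair2 1 2) (pair2 (corolla (n + 1)) s) = r"
    and u: "substitutable N 2 u (pair2 2 1) (pair2 v (corolla (l + 1)))"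
      "subst_sur N u (pair2 2 1) (pair2 v (corolla (l + 1))) = r"
    and x: "x \<in> carrier (P (n + 1))" and y: "y \<in> carrier (P (m + 1))"
    and z: "z \<in> carrier (P (l + 1))"
  shows "partial_ops P \<Gamma> (N, t) (partial_ops P \<Gamma> (m + l, s) z y) x =
    partial_ops P \<Gamma> (N, u) z (partial_ops P \<Gamma> (n + m, v) y x)"
proof -
  let ?L = "\<lambda>j\<in>{1..3::nat}. if j = 1 then x else if j = 2 then y else z"
  have three: "{1..3::nat} = {1, 2, 3}" by auto
  have L: "?L \<in> (\<Pi>\<^sub>E j\<in>{1..3}. carrier (P (fibre_card N r j + 1)))"
    using x y z by (auto simp: three n m l)
  have pos: "1 \<le> n" "1 \<le> m" "1 \<le> l"
    using fibre_nonempty[OF r] by (auto simp: n m l fibre_card_def One_nat_def Suc_le_eq card_gt_0_iff)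
  have card_Un: "card (fibre N r i \<union> fibre N r j) = fibre_card N r i + fibre_card N r j"
    if "i \<noteq> j" for i j
    unfolding fibre_card_def using that by (intro card_Un_disjoint) auto
  have tu: "t \<in> Sur N 2" "u \<in> Sur N 2" using t(1) u(1) by (simp_all add: substitutable_def)
  \<comment> \<open>The factorizations force the fibres of \<open>t\<close> and \<open>u\<close> to
    be unions of fibres of \<open>r\<close>, which supplies the arities needed to type the nested
    products.\<close>
  have "fibre N t 1 = fibre N r 1" "fibre N t 2 = fibre N r 2 \<union> fibre N r 3"
    "fibre N u 1 = fibre N r 1 \<union> fibre N r 2" "fibre N u 2 = fibre N r 3"
    using subst_sur_fibre_Union[OF t(1), of 1] subst_sur_fibre_Union[OF t(1), of 2]
      subst_sur_fibre_Union[OF u(1), of 1] subst_sur_fibre_Union[OF u(1), of 2]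
    unfolding t(2) u(2) by (simp_all add: atLeastAtMost_1_2)
  then have fc: "fibre_card N t 1 = n" "fibre_card N t 2 = m + l"
    "fibre_card N u 1 = n + m" "fibre_card N u 2 = l"
    unfolding n m l using card_Un[of 1 2] card_Un[of 2 3] by (simp_all add: fibre_card_def)
  have s: "s \<in> Sur (m + l) 2" and v: "v \<in> Sur (n + m) 2"
    using t(1) u(1) fc by (auto simp: substitutable_def atLeastAtMost_1_2)
  have fcs: "fibre_card (m + l) s 1 = m" "fibre_card (m + l) s 2 = l"
    using fibre_card_subst_sur[OF t(1), of 2 1] fibre_card_subst_sur[OF t(1), of 2 2]
    unfolding t(2) by (simp_all add: fc m l)
  have fcv: "fibre_card (n + m) v 1 = n" "fibre_card (n + m) v 2 = m"
    using fibre_card_subst_sur[OF u(1), of 1 1, symmetric]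
      fibre_card_subst_sur[OF u(1), of 1 2, symmetric]
    unfolding u(2) offset_1_2 pair2_simps add_0 fc n[symmetric] m[symmetric] by simp_all
  have sc: "\<Gamma> (m + l, 2, s) (pair2 y z) \<in> carrier (P (m + l + 1))"
    using y z by (intro total_closed s) (simp_all add: pair2_PiE_iff fcs)
  have vc: "\<Gamma> (n + m, 2, v) (pair2 x y) \<in> carrier (P (n + m + 1))"
    using x y by (intro total_closed v) (simp_all add: pair2_PiE_iff fcv)
  have L12: "(\<lambda>i\<in>{1..1}. ?L i) = (\<lambda>i\<in>{1..1}. x)" "(\<lambda>i\<in>{1..2}. ?L (1 + i)) = pair2 y z"
    "(\<lambda>i\<in>{1..2}. ?L i) = pair2 x y" "(\<lambda>i\<in>{1..1}. ?L (2 + i)) = (\<lambda>i\<in>{1..1}. z)"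
    unfolding pair2_def by (rule restrict_ext, force)+
  have "partial_ops P \<Gamma> (N, t) (partial_ops P \<Gamma> (m + l, s) z y) x =
      \<Gamma> (N, 2, t) (pair2 x (\<Gamma> (m + l, 2, s) (pair2 y z)))"
    using x y z sc by (simp add: partial_ops_apply s tu fc fcs)
  also have "\<dots> = \<Gamma> (N, 3, r) ?L"
    using total_subst_pair[OF t, of ?L] L total_corolla[OF pos(1) x] unfolding L12 fc by simp
  also have "\<dots> = \<Gamma> (N, 2, u) (pair2 (\<Gamma> (n + m, 2, v) (pair2 x y)) z)"
    using total_subst_pair[OF u, of ?L] L total_corolla[OF pos(3) z] unfolding L12 fc by simp
  also have "\<dots> = partial_ops P \<Gamma> (N, u) z (partial_ops P \<Gamma> (n + m, v) y x)"
    using x y z vc by (simp add: partial_ops_apply v tu fc fcv)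
  finally show ?thesis .
qed

lemma partial_permutad_partial_ops: "partial_permutad R P ident (partial_ops P \<Gamma>)"
  unfolding partial_permutad_def
proof (intro conjI allI impI ballI)
  show "unital_arity_graded_module R P ident" using total by (simp add: permutad_def)
  show "partial_ops P \<Gamma> \<in> (\<Pi>\<^sub>E (N, t)\<in>surjections2.
      bilinear_maps R (P (fibre_card N t 2 + 1)) (P (fibre_card N t 1 + 1)) (P (N + 1)))"
  proof (rule PiE_I)
    fix x assume "x \<in> surjections2"
    then show "partial_ops P \<Gamma> x \<in> (case x of (N, t) \<Rightarrow>
        bilinear_maps R (P (fibre_card N t 2 + 1)) (P (fibre_card N t 1 + 1)) (P (N + 1)))"
      using partial_ops_bilinear by (auto simp: surjections2_def)
  qed (simp add: partial_ops_def)
qed (rule partial_ops_diamond)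

text \<open>Splitting off the first fibre writes \<open>t\<close> as a substitution \<open>(t'; c, t'')\<close> with \<open>t''\<close> of target
  \<open>{1..k - 1}\<close>, so that \<open>\<Gamma> t\<close> is an iterated partial operation.\<close>

lemma total_eq_list_prod:
  assumes "1 \<le> k" "t \<in> Sur n k" "L \<in> (\<Pi>\<^sub>E j\<in>{1..k}. carrier (P (fibre_card n t j + 1)))"
  shows "\<Gamma> (n, k, t) L = list_prod (partial_ops P \<Gamma>) (blocks n k t L)"
  using assms
proof (induction k arbitrary: n t L rule: dec_induct)
  case base
  have "L \<in> extensional {1..1}" using base by (simp add: PiE_def)
  then have "L = (\<lambda>j\<in>{1..1}. L 1)"
    by (intro extensionalityI[of _ "{1..1}"]) auto
  moreover
  have "fibre n t 1 = {1..n}" using fibre_Union[OF base(1)] by simp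
  then have "L 1 \<in> carrier (P (n + 1))"
    using PiE_mem[OF base(2), of 1] by (simp add: fibre_card_def)
  ultimately have "\<Gamma> (n, 1, corolla (n + 1)) L = L 1"
    using total_corolla[OF Sur_source_pos[OF base(1)], of "L 1"] by simp
  then show ?case using Sur_one_eq[OF base(1)] by (simp add: blocks_1)
next
  case (step k)
  let ?op = "partial_ops P \<Gamma>"
  note partial = partial_permutad_partial_ops
  define X where "X = {1..n}"
  define A where "A = fibre n t 1"
  define Y where "Y = {a \<in> X. t a \<noteq> 1}"
  define f where "f = (\<lambda>a. if a \<in> A then 1 else 2::nat)"
  \<comment> \<open>Off the first fibre the labels of \<open>t\<close> run from 2 to
    \<open>Suc k\<close>. Subtracting 1 makes them a surjection onto \<open>{1..k}\<close>; the
    offset 1 of the second block restores them.\<close>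
  define g where "g = pair2 (\<lambda>_. 1) (\<lambda>a. t a - 1)"
  define t' where "t' = standardize X f"
  define t'' where "t'' = standardize Y (\<lambda>a. t a - 1)"
  let ?L = "\<lambda>i\<in>{1..k}. L (1 + i)"
  have X: "finite X" "card X = n" by (simp_all add: X_def)
  have finAY: "finite A" "finite Y" by (simp_all add: A_def Y_def X_def)
  have AY: "A \<union> Y = X" "A \<inter> Y = {}" by (auto simp: A_def Y_def X_def)
  have tX: "t ` X = {1..Suc k}" using SurD(2)[OF step.prems(1)] by (simp add: X_def)
  have tY: "(\<lambda>a. t a - 1) ` Y = {1..k}"
  proof -
    have "t ` Y = t ` X - {1}" by (auto simp: Y_def)
    also have "\<dots> = Suc ` {1..k}" unfolding tX by (auto simp: image_Suc_atLeastAtMost One_nat_def)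
    finally have "(\<lambda>i. i - 1) ` t ` Y = (\<lambda>i. i - 1) ` Suc ` {1..k}" by simp
    then show ?thesis by (simp add: image_image del: image_Suc_atLeastAtMost)
  qed
  have ne: "A \<noteq> {}" "Y \<noteq> {}"
    using fibre_nonempty[OF step.prems(1), of 1] tY step.hyps by (auto simp: A_def)
  have ff: "{a \<in> X. f a = 1} = A" "{a \<in> X. f a = 2} = Y"
    using AY by (auto simp: f_def)
  have fX: "f ` X = {1..2}" unfolding atLeastAtMost_1_2 AY(1)[symmetric] image_Un
    using ne AY(2) by (auto simp: f_def image_iff)
  have "\<And>j. j \<in> {1..2} \<Longrightarrow> g j ` {a \<in> X. f a = j} = {1..pair2 1 k j} \<and>
      pair2 (corolla (card A + 1)) t'' j = standardize {a \<in> X. f a = j} (g j)"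
    unfolding atLeastAtMost_1_2
    by (elim insertE emptyE; simp only: ff g_def pair2_simps corolla_eq_standardize finAY t''_def tY)
      (use ne in auto)
  note G = conjunct1[OF this] conjunct2[OF this]
  have sub: "substitutable n 2 t' (pair2 1 k) (pair2 (corolla (card A + 1)) t'')"
    using substitutable_standardize[OF X(1) fX G] unfolding t'_def X(2) .
  have "subst_sur n t' (pair2 1 k) (pair2 (corolla (card A + 1)) t'') =
      standardize X (\<lambda>a. offset (pair2 1 k) (f a) + g (f a) a)"
    using subst_sur_standardize[OF X(1) fX G] unfolding t'_def X(2) .
  also have "\<dots> = standardize X t"
  proof (rule standardize_cong[OF X(1)])
    fix a assume "a \<in> X"
    then have "t a \<in> {1..Suc k}" using tX by blast
    then show "offset (pair2 1 k) (f a) + g (f a) a = t a"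
      using \<open>a \<in> X\<close> by (auto simp: f_def A_def g_def X_def)
  qed
  also have "\<dots> = t" unfolding X_def using SurD(1)[OF step.prems(1)] by (rule standardize_interval)
  finally have sub_eq: "subst_sur n t' (pair2 1 k) (pair2 (corolla (card A + 1)) t'') = t" .
  have t': "t' \<in> Sur n 2" using sub by (simp add: substitutable_def)
  have fc': "fibre_card n t' 1 = card A" "fibre_card n t' 2 = card Y"
    using fibre_card_standardize[OF X(1), of f] unfolding X(2) t'_def[symmetric] by (simp_all add: ff)
  have t'': "t'' \<in> Sur (card Y) k" unfolding t''_def by (rule standardize_Sur[OF finAY(2) tY])
  have fibY: "fibre (card Y) t'' i = rank_in Y ` fibre n t (Suc i)" if "1 \<le> i" for i
  proof -
    have "{a \<in> Y. t a - 1 = i} = fibre n t (Suc i)" using that by (auto simp: Y_def X_def)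
    then show ?thesis unfolding t''_def fibre_standardize[OF finAY(2)] by simp
  qed
  have fcY: "fibre_card (card Y) t'' i = fibre_card n t (Suc i)" if "1 \<le> i" for i
  proof -
    have "inj_on (rank_in Y) (fibre n t (Suc i))"
      by (rule inj_on_subset[OF rank_in_inj[OF finAY(2)]]) (use that in \<open>auto simp: Y_def X_def\<close>)
    then show ?thesis by (simp only: fibre_card_def fibY[OF that] card_image)
  qed
  have L1: "L 1 \<in> carrier (P (card A + 1))"
    using PiE_mem[OF step.prems(2), of 1] by (simp add: fibre_card_def A_def)
  have L'': "?L \<in> (\<Pi>\<^sub>E j\<in>{1..k}. carrier (P (fibre_card (card Y) t'' j + 1)))"
  proof (rule PiE_I)
    fix i assume i: "i \<in> {1..k}"
    then show "?L i \<in> carrier (P (fibre_card (card Y) t'' i + 1))"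
      using PiE_mem[OF step.prems(2), of "Suc i"] by (simp add: fcY One_nat_def)
  qed (simp only: restrict_def if_False)
  let ?qs = "map (\<lambda>i. (fibre n t (Suc i), L (Suc i))) [1..<Suc k]"
  have blocks: "blocks n (Suc k) t L = (A, L 1) # ?qs"
  proof -
    have "[1..<Suc (Suc k)] = 1 # map Suc [1..<Suc k]"
      by (simp add: upt_conv_Cons map_Suc_upt del: upt_Suc)
    then show ?thesis by (simp add: blocks_def A_def o_def del: upt_Suc)
  qed
  have adm: "admissible P ((A, L 1) # ?qs)"
    using blocks_admissible[OF step.prems(1), of L P] step.prems(2) unfolding blocks PiE_def by blast
  have "support ((A, L 1) # ?qs) = X"
    using blocks_support[OF step.prems(1), of L] unfolding blocks X_def .
  then have supp: "support ?qs = Y" using AY adm by auto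
  \<comment> \<open>The induction hypothesis speaks of \<open>t''\<close>, whose source is
    \<open>{1..card Y}\<close>. Undoing the relabelling turns its product into that of the remaining
    fibres of \<open>t\<close>.\<close>
  have "blocks (card Y) k t'' ?L = map (\<lambda>p. (rank_in Y ` fst p, snd p)) ?qs"
    using fibY by (auto simp: blocks_def One_nat_def)
  moreover have "list_prod ?op (map (\<lambda>p. (rank_in Y ` fst p, snd p)) ?qs) = list_prod ?op ?qs"
  proof (rule list_prod_image)
    show "admissible P ?qs" using adm by simp
    show "strict_mono_on (support ?qs) (rank_in Y)" unfolding supp by (rule rank_in_strict_mono[OF finAY(2)])
  qed
  ultimately have IH: "\<Gamma> (card Y, k, t'') ?L = list_prod ?op ?qs"
    using step.IH[OF t'' L''] by (simp only:)
  have closed: "\<Gamma> (card Y, k, t'') ?L \<in> carrier (P (card Y + 1))"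
    by (rule total_closed[OF t'' step.hyps(1) L''])
  have "1 \<le> card A" using ne finAY by (simp add: One_nat_def Suc_le_eq card_gt_0_iff)
  moreover have "(\<lambda>i\<in>{1..1}. L i) = (\<lambda>i\<in>{1..1}. L 1)" by (rule restrict_ext) simp
  ultimately have one: "\<Gamma> (card A, 1, corolla (card A + 1)) (\<lambda>i\<in>{1..1}. L i) = L 1"
    using total_corolla L1 by simp
  have "\<Gamma> (n, Suc k, t) L = \<Gamma> (n, 2, t') (pair2 (L 1) (\<Gamma> (card Y, k, t'') ?L))"
    using total_subst_pair[OF sub sub_eq, of L] step.prems(2)
    unfolding fc' one plus_1_eq_Suc by blast
  also have "\<dots> = ?op (n, t') (\<Gamma> (card Y, k, t'') ?L) (L 1)"
    using L1 closed by (intro partial_ops_apply[symmetric] t') (simp_all add: fc')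
  \<comment> \<open>By construction \<open>t'\<close> is the standardized labelling of
    \<open>A\<close> against \<open>Y\<close> that \<open>merge\<close> uses.\<close>
  also have "\<dots> = merge ?op A Y (L 1) (list_prod ?op ?qs)"
    unfolding merge_def AY X IH t'_def f_def ..
  also have "\<dots> = list_prod ?op ((A, L 1) # ?qs)"
    using step.hyps(1) by (simp add: list_prod_Cons supp[symmetric] del: upt_Suc)
  finally show ?case unfolding blocks .
qed

text \<open>This is the injectivity half: \<Gamma> is rebuilt from its partial operations.
  Extensionality in both the index and the arguments upgrades agreement on legal inputs to
  equality.\<close>

lemma total_ops_partial_ops: "total_ops P (partial_ops P \<Gamma>) = \<Gamma>"
proof (rule ext)
  fix x
  have \<Gamma>: "\<Gamma> \<in> extensional surjections"
    using total by (auto simp: permutad_def PiE_def)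
  show "total_ops P (partial_ops P \<Gamma>) x = \<Gamma> x"
  proof (cases "x \<in> surjections")
    case False
    then show ?thesis using extensional_arb[OF \<Gamma> False] by (simp add: total_ops_def)
  next
    case True
    then obtain n k t where x: "x = (n, k, t)" and t: "t \<in> Sur n k" and k: "1 \<le> k"
      by (auto simp: surjections_def)
    let ?D = "\<Pi>\<^sub>E j\<in>{1..k}. carrier (P (fibre_card n t j + 1))"
    have "\<Gamma> (n, k, t) \<in> extensional ?D"
      using total_multilinear[OF t k] by (auto simp: multilinear_maps_def PiE_def)
    moreover have "total_ops P (partial_ops P \<Gamma>) (n, k, t) \<in> extensional ?D"
      using True x by (simp add: total_ops_def)
    ultimately show ?thesis
      unfolding x using total_ops_apply[OF t k] total_eq_list_prod[OF k t]
      by (intro extensionalityI[of _ ?D]) auto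
  qed
qed

end

theorem theorem2p4:
  fixes R :: "('r, 'p) ring_scheme"
    and P :: "nat \<Rightarrow> ('r, 'a, 'm) module_scheme"
    and ident :: 'a
  assumes "unital_arity_graded_module R P ident"
  shows "bij_betw (partial_ops P) {\<Gamma>. permutad R P ident \<Gamma>} {op. partial_permutad R P ident op}"
  by (rule bij_betw_byWitness[where f' = "total_ops P"])
    (auto intro: partial_permutad_partial_ops permutad_total_ops
      simp: total_ops_partial_ops partial_ops_total_ops)

end
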